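(* Let $K$ be a semi-simple compact connected Lie group with Lie algebra $\mathfrak{k}$, let $\mathfrak{h}$ be a Cartan subalgebra of $\mathfrak{k}$, and let $B$ be an $\operatorname{Ad}$-invariant convex body in $\mathfrak{k}$ containing $0$ such that $B\cap\mathfrak{h}=P^\circ$ is a polytope. Then all faces of $B$ are abelian if and only if all extreme points of $P$ are regular.
   Context: A convex body is a compact convex set with non-empty interior; a polytope is the convex hull of finitely many points. $\langle\cdot,\cdot\rangle$ is minus the Killing form of $\mathfrak{k}$. Polars are taken in $\mathfrak{h}$: $E^\circ=\{x\in\mathfrak{h}:\langle x,y\rangle\le1\ \forall y\in E\}$; thus $P=(B\cap\mathfrak{h})^\circ$ is the polytope polar to $B\cap\mathfrak{h}$. The faces of $B$ are the (exposed) faces $F_x(B)=\{v\in B:\langle v,x\rangle=\max_{u\in B}\langle u,x\rangle\}$ for $0\neq x\in\mathfrak{k}$. A face is abelian if its elements commute pairwise. An element of $\mathfrak{k}$ is regular if its centralizer in $\mathfrak{k}$ is a Cartan subalgebra. *)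

theory Defs
  imports "HOL-Analysis.Analysis" "HOL-Algebra.Group"
begin

text \<open>
  \<open>Ck_on k f S\<close> is meant for open \<open>S\<close>: \<open>f\<close> is \<open>k\<close> times continuously differentiable on \<open>S\<close>.
\<close>

fun Ck_on :: "nat \<Rightarrow> ('a::real_normed_vector \<Rightarrow> 'b::real_normed_vector) \<Rightarrow> 'a set \<Rightarrow> bool" where
  "Ck_on 0 f S \<longleftrightarrow> continuous_on S f"
| "Ck_on (Suc k) f S \<longleftrightarrow>
     (\<forall>x\<in>S. f differentiable (at x)) \<and>
     (\<forall>v. Ck_on k (\<lambda>x. frechet_derivative f (at x) v) S)"

definition smooth_on :: "('a::real_normed_vector \<Rightarrow> 'b::real_normed_vector) \<Rightarrow> 'a set \<Rightarrow> bool" where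
  "smooth_on f S \<longleftrightarrow> (\<forall>k. Ck_on k f S)"

text \<open>
  A Lie group is a group with a smooth manifold structure for which multiplication and inversion
  are smooth. The manifold structure is a Hausdorff, second countable topology \<open>T\<close> on the carrier
  and a (not necessarily maximal) smooth atlas \<open>\<A>\<close>. A chart is a pair of an open set \<open>U\<close> and a map
  that is a homeomorphism from \<open>U\<close> onto an open subset of the model space \<open>'e\<close>; outside \<open>U\<close> the
  map carries no information.
\<close>

locale lie_group = group K
  for K :: "('g, 'z) monoid_scheme" (structure)
    and T :: "'g topology"
    and \<A> :: "('g set \<times> ('g \<Rightarrow> 'e::euclidean_space)) set" +
  assumes topspace_eq: "topspace T = carrier K"
    and Hausdorff: "Hausdorff_space T"
    and second_countable: "second_countable T"
    and chart_dom: "(U, \<phi>) \<in> \<A> \<Longrightarrow> openin T U"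
    and chart_img: "(U, \<phi>) \<in> \<A> \<Longrightarrow> open (\<phi> ` U)"
    and chart_homeo: "(U, \<phi>) \<in> \<A> \<Longrightarrow>
          homeomorphic_map (subtopology T U) (top_of_set (\<phi> ` U)) \<phi>"
    and charts_cover: "carrier K \<subseteq> (\<Union>(U, \<phi>)\<in>\<A>. U)"
    and charts_compatible: "(U, \<phi>) \<in> \<A> \<Longrightarrow> (V, \<psi>) \<in> \<A> \<Longrightarrow>
          smooth_on (\<lambda>x. \<psi> (inv_into U \<phi> x)) (\<phi> ` (U \<inter> V))"
    and mult_continuous:
          "continuous_map (prod_topology T T) T (\<lambda>(g, h). g \<otimes> h)"
    and inv_continuous: "continuous_map T T (\<lambda>g. inv g)"
    and mult_smooth: "(U, \<phi>) \<in> \<A> \<Longrightarrow> (V, \<psi>) \<in> \<A> \<Longrightarrow> (W, \<eta>) \<in> \<A> \<Longrightarrow>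
          smooth_on (\<lambda>(x, y). \<eta> (inv_into U \<phi> x \<otimes> inv_into V \<psi> y))
            {(x, y). x \<in> \<phi> ` U \<and> y \<in> \<psi> ` V \<and> inv_into U \<phi> x \<otimes> inv_into V \<psi> y \<in> W}"
    and inv_smooth: "(U, \<phi>) \<in> \<A> \<Longrightarrow> (V, \<psi>) \<in> \<A> \<Longrightarrow>
          smooth_on (\<lambda>x. \<psi> (inv (inv_into U \<phi> x)))
            {x. x \<in> \<phi> ` U \<and> inv (inv_into U \<phi> x) \<in> V}"

text \<open>
  Let \<open>(U, \<phi>)\<close> be a chart with \<open>\<one> \<in> U\<close>. The differential of \<open>\<phi>\<close> identifies the tangent space of
  \<open>K\<close> at \<open>\<one>\<close>, i.e. the Lie algebra, with the whole model space \<open>'e\<close>. In this identification, \<open>Ad g\<close>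
  is the differential at \<open>\<one>\<close> of the conjugation by \<open>g\<close>, and \<open>[X, Y]\<close> is the differential at \<open>\<one>\<close>, in
  direction \<open>X\<close>, of the map \<open>g \<mapsto> Ad g Y\<close> (that is, \<open>ad\<close> is the differential of \<open>Ad\<close>).
\<close>

definition Ad ::
  "('g, 'z) monoid_scheme \<Rightarrow> 'g set \<Rightarrow> ('g \<Rightarrow> 'e::euclidean_space) \<Rightarrow> 'g \<Rightarrow> 'e \<Rightarrow> 'e" where
  "Ad K U \<phi> g Y =
     frechet_derivative (\<lambda>x. \<phi> (g \<otimes>\<^bsub>K\<^esub> inv_into U \<phi> x \<otimes>\<^bsub>K\<^esub> inv\<^bsub>K\<^esub> g)) (at (\<phi> \<one>\<^bsub>K\<^esub>)) Y"

definition lie_bracket ::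
  "('g, 'z) monoid_scheme \<Rightarrow> 'g set \<Rightarrow> ('g \<Rightarrow> 'e::euclidean_space) \<Rightarrow> 'e \<Rightarrow> 'e \<Rightarrow> 'e" where
  "lie_bracket K U \<phi> X Y =
     frechet_derivative (\<lambda>x. Ad K U \<phi> (inv_into U \<phi> x) Y) (at (\<phi> \<one>\<^bsub>K\<^esub>)) X"

text \<open>
  A Lie algebra is given by its bracket \<open>br\<close> on the whole type.
\<close>

definition lie_subalgebra :: "('e::real_vector \<Rightarrow> 'e \<Rightarrow> 'e) \<Rightarrow> 'e set \<Rightarrow> bool" where
  "lie_subalgebra br L \<longleftrightarrow> subspace L \<and> (\<forall>x\<in>L. \<forall>y\<in>L. br x y \<in> L)"

definition lie_ideal :: "('e::real_vector \<Rightarrow> 'e \<Rightarrow> 'e) \<Rightarrow> 'e set \<Rightarrow> bool" where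
  "lie_ideal br I \<longleftrightarrow> subspace I \<and> (\<forall>x. \<forall>y\<in>I. br x y \<in> I)"

definition bracket_span :: "('e::real_vector \<Rightarrow> 'e \<Rightarrow> 'e) \<Rightarrow> 'e set \<Rightarrow> 'e set \<Rightarrow> 'e set" where
  "bracket_span br L M = span {br x y | x y. x \<in> L \<and> y \<in> M}"

primrec lower_central :: "('e::real_vector \<Rightarrow> 'e \<Rightarrow> 'e) \<Rightarrow> 'e set \<Rightarrow> nat \<Rightarrow> 'e set" where
  "lower_central br L 0 = L"
| "lower_central br L (Suc n) = bracket_span br L (lower_central br L n)"

primrec derived_series :: "('e::real_vector \<Rightarrow> 'e \<Rightarrow> 'e) \<Rightarrow> 'e set \<Rightarrow> nat \<Rightarrow> 'e set" where
  "derived_series br L 0 = L"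
| "derived_series br L (Suc n) = bracket_span br (derived_series br L n) (derived_series br L n)"

definition lie_nilpotent :: "('e::real_vector \<Rightarrow> 'e \<Rightarrow> 'e) \<Rightarrow> 'e set \<Rightarrow> bool" where
  "lie_nilpotent br L \<longleftrightarrow> (\<exists>n. lower_central br L n = {0})"

definition lie_solvable :: "('e::real_vector \<Rightarrow> 'e \<Rightarrow> 'e) \<Rightarrow> 'e set \<Rightarrow> bool" where
  "lie_solvable br L \<longleftrightarrow> (\<exists>n. derived_series br L n = {0})"

definition lie_semisimple :: "('e::real_vector \<Rightarrow> 'e \<Rightarrow> 'e) \<Rightarrow> bool" where
  "lie_semisimple br \<longleftrightarrow> (\<forall>I. lie_ideal br I \<and> lie_solvable br I \<longrightarrow> I = {0})"

definition lie_normalizer :: "('e::real_vector \<Rightarrow> 'e \<Rightarrow> 'e) \<Rightarrow> 'e set \<Rightarrow> 'e set" where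
  "lie_normalizer br L = {x. \<forall>y\<in>L. br x y \<in> L}"

definition cartan_subalgebra :: "('e::real_vector \<Rightarrow> 'e \<Rightarrow> 'e) \<Rightarrow> 'e set \<Rightarrow> bool" where
  "cartan_subalgebra br H \<longleftrightarrow>
     lie_subalgebra br H \<and> lie_nilpotent br H \<and> lie_normalizer br H = H"

definition lie_centralizer :: "('e::real_vector \<Rightarrow> 'e \<Rightarrow> 'e) \<Rightarrow> 'e \<Rightarrow> 'e set" where
  "lie_centralizer br x = {y. br x y = 0}"

definition lie_regular :: "('e::real_vector \<Rightarrow> 'e \<Rightarrow> 'e) \<Rightarrow> 'e \<Rightarrow> bool" where
  "lie_regular br x \<longleftrightarrow> cartan_subalgebra br (lie_centralizer br x)"

definition lie_commuting :: "('e::real_vector \<Rightarrow> 'e \<Rightarrow> 'e) \<Rightarrow> 'e set \<Rightarrow> bool" where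
  "lie_commuting br E \<longleftrightarrow> (\<forall>x\<in>E. \<forall>y\<in>E. br x y = 0)"

definition endo_trace :: "('e::euclidean_space \<Rightarrow> 'e) \<Rightarrow> real" where
  "endo_trace f = (\<Sum>b\<in>Basis. f b \<bullet> b)"

definition killing_form :: "('e::euclidean_space \<Rightarrow> 'e \<Rightarrow> 'e) \<Rightarrow> 'e \<Rightarrow> 'e \<Rightarrow> real" where
  "killing_form br x y = endo_trace (br x \<circ> br y)"

text \<open>
  Duality is with respect to minus the Killing form. The inner product of the class
  \<^class>\<open>euclidean_space\<close> depends on the chart and only serves to compute the trace.
\<close>

definition neg_killing :: "('e::euclidean_space \<Rightarrow> 'e \<Rightarrow> 'e) \<Rightarrow> 'e \<Rightarrow> 'e \<Rightarrow> real" where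
  "neg_killing br x y = - killing_form br x y"

definition convex_body :: "'e::real_normed_vector set \<Rightarrow> bool" where
  "convex_body B \<longleftrightarrow> compact B \<and> convex B \<and> interior B \<noteq> {}"

definition polar_in :: "('e::euclidean_space \<Rightarrow> 'e \<Rightarrow> 'e) \<Rightarrow> 'e set \<Rightarrow> 'e set \<Rightarrow> 'e set" where
  "polar_in br H E = {x\<in>H. \<forall>y\<in>E. neg_killing br x y \<le> 1}"

definition exposed_face :: "('e::euclidean_space \<Rightarrow> 'e \<Rightarrow> 'e) \<Rightarrow> 'e set \<Rightarrow> 'e \<Rightarrow> 'e set" where
  "exposed_face br B x = {v\<in>B. \<forall>u\<in>B. neg_killing br u x \<le> neg_killing br v x}"

end

theory Submission
  imports Defs
begin

text \<open>
  Let \<open>\<langle>\<cdot>, \<cdot>\<rangle>\<close> be minus the Killing form. Since \<open>B\<close> is a body invariant under all \<open>exp (t ad Y)\<close>,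
  these flows are bounded, so \<open>ad Y\<close> is skew for some inner product and \<open>tr ((ad Y)\<^sup>2) \<le> 0\<close> with
  equality only for \<open>ad Y = 0\<close>; hence \<open>\<langle>\<cdot>, \<cdot>\<rangle>\<close> is positive definite. Maximality of \<open>\<langle>v, p\<rangle>\<close> along the
  flows shows that the face \<open>F\<^sub>p\<close> lies in the centralizer of \<open>p\<close>; for \<open>p\<close> in \<open>H\<close> it also
  meets \<open>H\<close>, so \<open>P\<close> lies in the polar of all of \<open>B\<close>.

  If the extreme points of \<open>P\<close> are regular, a face \<open>F\<^sub>x\<close> with \<open>x \<in> H\<close>, \<open>x\<close> scaled into the boundary
  of \<open>P\<close>, is contained in \<open>F\<^sub>p\<close> for an extreme point \<open>p\<close> of the face of \<open>P\<close> containing \<open>x\<close>, hence in a Cartan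
  subalgebra. Every \<open>x\<close> can be moved into \<open>H\<close>. Conversely, for an extreme point \<open>p\<close> of \<open>P\<close> the
  vertices of \<open>B \<inter> H\<close> in \<open>F\<^sub>p\<close> span \<open>H\<close>. If \<open>F\<^sub>p\<close> is abelian and \<open>Y\<close> commutes with \<open>p\<close>, then
  \<open>exp (t ad Y)\<close> preserves \<open>F\<^sub>p\<close>, and differentiating \<open>[s, exp (t ad Y) s'] = 0\<close> gives
  \<open>[h, [Y, h]] = 0\<close>, that is \<open>[Y, h] = 0\<close>, for all \<open>h \<in> H\<close>, so \<open>Y \<in> H\<close>.

  The only facts needed about the group are that the bracket is a Lie bracket and that
  \<open>exp (t ad Y) b \<in> B\<close> for \<open>b \<in> B\<close>; the latter is the limit of \<open>(Ad c(t/n))\<^sup>n b\<close> for a curve \<open>c\<close> through \<open>1\<close> with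
  velocity \<open>Y\<close>.
\<close>

section \<open>The exponential of a linear map\<close>

text \<open>The one-parameter group exp (tA), written as a series of vectors, so that convergence is
  a matter of the ambient norm of vectors.\<close>

definition lin_exp :: "('e::euclidean_space \<Rightarrow> 'e) \<Rightarrow> real \<Rightarrow> 'e \<Rightarrow> 'e" where
  "lin_exp A t v = (\<Sum>n. (t ^ n / fact n) *\<^sub>R (A ^^ n) v)"

lemma linear_funpow:
  fixes A :: "'e::real_vector \<Rightarrow> 'e"
  assumes "linear A"
  shows "linear (A ^^ n)"
  using assms
proof (induction n)
  case 0
  show ?case by (rule linearI) simp_all
next
  case (Suc n)
  then have "linear (A \<circ> (A ^^ n))" using linear_compose by blast
  then show ?case by (simp add: o_def)
qed

lemma norm_funpow_le:
  fixes A :: "'e::real_normed_vector \<Rightarrow> 'e"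
  assumes "\<And>v. norm (A v) \<le> C * norm v" "0 \<le> C"
  shows "norm ((A ^^ n) v) \<le> C ^ n * norm v"
proof (induction n)
  case (Suc n)
  have "norm ((A ^^ Suc n) v) \<le> C * norm ((A ^^ n) v)" using assms(1) by simp
  also have "\<dots> \<le> C * (C ^ n * norm v)" using Suc assms(2) by (rule mult_left_mono)
  finally show ?case by (simp add: mult.assoc)
qed simp

context
  fixes A :: "'e::euclidean_space \<Rightarrow> 'e"
  assumes A: "linear A"
begin

lemma norm_lin_exp_term_le:
  assumes "\<And>v. norm (A v) \<le> C * norm v" "0 \<le> C"
  shows "norm ((t ^ n / fact n) *\<^sub>R (A ^^ n) v) \<le> ((C * \<bar>t\<bar>) ^ n /\<^sub>R fact n) * norm v"
proof -
  have "\<bar>t\<bar> ^ n / fact n * norm ((A ^^ n) v) \<le> \<bar>t\<bar> ^ n / fact n * (C ^ n * norm v)"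
    using norm_funpow_le[OF assms] by (intro mult_left_mono) auto
  then show ?thesis by (simp add: power_abs power_mult_distrib divide_inverse mult_ac abs_mult)
qed

lemma summable_norm_lin_exp: "summable (\<lambda>n. norm ((t ^ n / fact n) *\<^sub>R (A ^^ n) v))"
proof -
  obtain C where C: "C > 0" "\<And>v. norm (A v) \<le> C * norm v"
    using linear_bounded_pos[OF A] by blast
  have "\<exists>N. \<forall>n\<ge>N. norm (norm ((t ^ n / fact n) *\<^sub>R (A ^^ n) v)) \<le> ((C * \<bar>t\<bar>) ^ n /\<^sub>R fact n) * norm v"
    using norm_lin_exp_term_le[OF C(2) less_imp_le[OF C(1)], where t = t and v = v]
    by (intro exI[of _ 0] allI impI) (simp only: real_norm_def abs_norm_cancel)
  moreover have "summable (\<lambda>n. ((C * \<bar>t\<bar>) ^ n /\<^sub>R fact n) * norm v)"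
    by (intro summable_mult2 summable_exp_generic)
  ultimately show ?thesis by (rule summable_comparison_test)
qed

lemma summable_lin_exp: "summable (\<lambda>n. (t ^ n / fact n) *\<^sub>R (A ^^ n) v)"
  by (rule summable_norm_cancel[OF summable_norm_lin_exp])

lemma norm_lin_exp_le:
  assumes "\<And>v. norm (A v) \<le> C * norm v" "0 \<le> C"
  shows "norm (lin_exp A t v) \<le> exp (C * \<bar>t\<bar>) * norm v"
proof -
  have "norm (lin_exp A t v) \<le> (\<Sum>n. norm ((t ^ n / fact n) *\<^sub>R (A ^^ n) v))"
    unfolding lin_exp_def by (rule summable_norm[OF summable_norm_lin_exp])
  also have "\<dots> \<le> (\<Sum>n. ((C * \<bar>t\<bar>) ^ n /\<^sub>R fact n) * norm v)"
    by (intro suminf_le norm_lin_exp_term_le assms summable_norm_lin_exp summable_mult2 summable_exp_generic)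
  also have "\<dots> = exp (C * \<bar>t\<bar>) * norm v"
    unfolding exp_def by (rule suminf_mult2[symmetric]) (rule summable_exp_generic)
  finally show ?thesis .
qed

lemma lin_exp_0 [simp]: "lin_exp A 0 v = v"
proof -
  have "(\<Sum>n. (0 ^ n / fact n) *\<^sub>R (A ^^ n) v) = (\<Sum>n\<in>{0}. (0 ^ n / fact n) *\<^sub>R (A ^^ n) v)"
    by (rule suminf_finite) (auto simp: power_0_left)
  then show ?thesis by (simp add: lin_exp_def)
qed

lemma linear_lin_exp: "linear (lin_exp A t)"
proof (rule linearI)
  fix u v :: 'e and c :: real
  note L = linear_funpow[OF A]
  show "lin_exp A t (u + v) = lin_exp A t u + lin_exp A t v"
    unfolding lin_exp_def by (simp add: linear_add[OF L] scaleR_add_right suminf_add[OF summable_lin_exp summable_lin_exp])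
  show "lin_exp A t (c *\<^sub>R v) = c *\<^sub>R lin_exp A t v"
    unfolding lin_exp_def suminf_scaleR_right[OF summable_lin_exp]
    by (simp add: linear_scale[OF L] mult.commute)
qed

lemma lin_exp_commute: "A (lin_exp A t v) = lin_exp A t (A v)"
proof -
  have "bounded_linear A" using A linear_conv_bounded_linear by blast
  then have "A (lin_exp A t v) = (\<Sum>n. A ((t ^ n / fact n) *\<^sub>R (A ^^ n) v))"
    unfolding lin_exp_def by (rule bounded_linear.suminf[OF _ summable_lin_exp])
  also have "\<dots> = lin_exp A t (A v)"
    unfolding lin_exp_def by (simp add: linear_scale[OF A] funpow_swap1)
  finally show ?thesis .
qed

section \<open>Flow equation, uniqueness and group law of the exponential\<close>

lemma lin_exp_inner:
  "lin_exp A t v \<bullet> b = (\<Sum>n. ((A ^^ n) v \<bullet> b / fact n) * t ^ n)"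
  "summable (\<lambda>n. ((A ^^ n) v \<bullet> b / fact n) * t ^ n)"
proof -
  note B = bounded_linear_inner_left[of b]
  have eq: "(t ^ n / fact n) *\<^sub>R (A ^^ n) v \<bullet> b = ((A ^^ n) v \<bullet> b / fact n) * t ^ n" for n
    by simp
  show "lin_exp A t v \<bullet> b = (\<Sum>n. ((A ^^ n) v \<bullet> b / fact n) * t ^ n)"
    unfolding lin_exp_def bounded_linear.suminf[OF B summable_lin_exp] eq ..
  show "summable (\<lambda>n. ((A ^^ n) v \<bullet> b / fact n) * t ^ n)"
    using bounded_linear.summable[OF B summable_lin_exp[of t v]] unfolding eq .
qed

text \<open>Each coordinate is a real power series converging everywhere, so it may be
  differentiated term by term.\<close>

lemma lin_exp_has_vector_derivative:
  "((\<lambda>t. lin_exp A t v) has_vector_derivative A (lin_exp A t v)) (at t within S)"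
proof -
  have "((\<lambda>t. lin_exp A t v \<bullet> b) has_derivative (\<lambda>h. (h *\<^sub>R lin_exp A t (A v)) \<bullet> b)) (at t)" for b
  proof -
    let ?c = "\<lambda>n. (A ^^ n) v \<bullet> b / fact n"
    \<comment> \<open>Shifting the coefficients by one trades a power of t for an application of A
      to v.\<close>
    have "diffs ?c n = (A ^^ n) (A v) \<bullet> b / fact n" for n
      by (simp add: diffs_def funpow_swap1 divide_simps)
    then have "((\<lambda>t. lin_exp A t v \<bullet> b) has_field_derivative (lin_exp A t (A v) \<bullet> b)) (at t)"
      using termdiffs_strong_converges_everywhere[of ?c t] lin_exp_inner by simp
    then show ?thesis by (simp add: has_field_derivative_def mult.commute[of _ "lin_exp A t (A v) \<bullet> b"])
  qed
  then show ?thesis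
    unfolding has_vector_derivative_def lin_exp_commute
    by (subst has_derivative_componentwise_within) (blast intro: has_derivative_at_withinI)
qed

text \<open>The curve obtained by applying exp ((t - s) A) to \<open>w s\<close> has derivative 0 in
  s, so its values at s = t and s = 0 agree.\<close>

lemma lin_exp_unique:
  assumes w: "\<And>s. (w has_vector_derivative A (w s)) (at s)"
  shows "w t = lin_exp A t (w 0)"
proof -
  \<comment> \<open>Operator and argument both depend on s; the expansion in \<open>Basis\<close>
    makes each summand a scalar times a vector, to which the product rule applies.\<close>
  define f where "f s = (\<Sum>b\<in>Basis. (w s \<bullet> b) *\<^sub>R lin_exp A (t - s) b)" for s
  have f: "f s = lin_exp A (t - s) (w s)" for s
    unfolding f_def using linear_sum[OF linear_lin_exp] linear_scale[OF linear_lin_exp]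
    by (metis (mono_tags, lifting) euclidean_representation sum.cong)
  have "(f has_vector_derivative 0) (at s)" for s
  proof -
    have 1: "((\<lambda>s. w s \<bullet> b) has_real_derivative (A (w s) \<bullet> b)) (at s)" for b
      using bounded_linear.has_vector_derivative[OF bounded_linear_inner_left w]
      by (simp add: has_real_derivative_iff_has_vector_derivative)
    have 2: "((\<lambda>s. lin_exp A (t - s) b) has_vector_derivative (-1) *\<^sub>R A (lin_exp A (t - s) b)) (at s)" for b
      using vector_diff_chain_at[of "\<lambda>s. t - s" "-1" s "\<lambda>s. lin_exp A s b"] lin_exp_has_vector_derivative[of b "t - s" UNIV]
      by (force simp: o_def intro!: derivative_eq_intros)
    have "(f has_vector_derivative
        (\<Sum>b\<in>Basis. (w s \<bullet> b) *\<^sub>R ((-1) *\<^sub>R A (lin_exp A (t - s) b)) + (A (w s) \<bullet> b) *\<^sub>R lin_exp A (t - s) b)) (at s)"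
      unfolding f_def by (intro has_vector_derivative_sum has_vector_derivative_scaleR 1 2)
    moreover have "(\<Sum>b\<in>Basis. (w s \<bullet> b) *\<^sub>R ((-1) *\<^sub>R A (lin_exp A (t - s) b))) = - lin_exp A (t - s) (A (w s))"
    proof -
      have "(\<Sum>b\<in>Basis. (w s \<bullet> b) *\<^sub>R ((-1) *\<^sub>R A (lin_exp A (t - s) b)))
          = - A (\<Sum>b\<in>Basis. (w s \<bullet> b) *\<^sub>R lin_exp A (t - s) b)"
        by (simp add: linear_sum[OF A] linear_scale[OF A] sum_negf)
      also have "\<dots> = - lin_exp A (t - s) (A (w s))"
        using f[of s] lin_exp_commute by (simp add: f_def)
      finally show ?thesis .
    qed
    moreover have "(\<Sum>b\<in>Basis. (A (w s) \<bullet> b) *\<^sub>R lin_exp A (t - s) b) = lin_exp A (t - s) (A (w s))"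
      using linear_sum[OF linear_lin_exp] linear_scale[OF linear_lin_exp]
      by (metis (mono_tags, lifting) euclidean_representation sum.cong)
    ultimately show ?thesis by (simp only: sum.distrib) simp
  qed
  then have "f t = f 0"
    using has_vector_derivative_zero_constant[of UNIV f] by (metis UNIV_I convex_UNIV)
  then show ?thesis by (simp add: f)
qed

text \<open>As functions of s both sides solve the flow equation, with the value
  \<open>lin_exp A t v\<close> at s = 0.\<close>

lemma lin_exp_add: "lin_exp A (s + t) v = lin_exp A s (lin_exp A t v)"
proof -
  have "((\<lambda>s. lin_exp A (s + t) v) has_vector_derivative A (lin_exp A (s + t) v)) (at s)" for s
    using vector_diff_chain_at[of "\<lambda>s. s + t" 1 s "\<lambda>s. lin_exp A s v"] lin_exp_has_vector_derivative[of v "s + t" UNIV]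
    by (force simp: o_def intro!: derivative_eq_intros)
  from lin_exp_unique[OF this] show ?thesis by simp
qed

lemma lin_exp_minus: "lin_exp A (- t) (lin_exp A t v) = v" "lin_exp A t (lin_exp A (- t) v) = v"
  using lin_exp_add[of "- t" t v] lin_exp_add[of t "- t" v] by auto

text \<open>Euler's broken lines \<open>M (t / n) ^ n b\<close> stay in \<open>B\<close> and converge to \<open>lin_exp A t b\<close>.\<close>

lemma lin_exp_invariant:
  assumes B: "compact B" "b \<in> B" and "\<delta> > 0"
    and M: "\<And>s. \<bar>s\<bar> < \<delta> \<Longrightarrow> linear (M s)" "\<And>s. \<bar>s\<bar> < \<delta> \<Longrightarrow> M s ` B \<subseteq> B"
    and M0: "\<And>v. M 0 v = v" and M': "\<And>v. ((\<lambda>s. M s v) has_vector_derivative A v) (at 0)"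
  shows "lin_exp A t b \<in> B"
proof (cases "t = 0")
  case False
  obtain C where C: "C > 0" "\<And>v. norm (A v) \<le> C * norm v"
    using linear_bounded_pos[OF A] by blast
  obtain R where R: "R > 0" "\<And>v. v \<in> B \<Longrightarrow> norm v \<le> R"
    using compact_imp_bounded[OF B(1)] bounded_pos by blast
  \<comment> \<open>A bound, up to the norm of the argument, for the error of a single step of size
    h.\<close>
  define e where "e h = (\<Sum>u\<in>Basis. norm (lin_exp A h u - M h u))" for h
  have step: "norm (lin_exp A h v - M h v) \<le> e h * norm v" if "\<bar>h\<bar> < \<delta>" for h v
  proof -
    let ?D = "\<lambda>v. lin_exp A h v - M h v"
    have L: "linear ?D" using linear_lin_exp M(1)[OF that] by (rule linear_compose_sub)
    have "?D v = (\<Sum>u\<in>Basis. (v \<bullet> u) *\<^sub>R ?D u)"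
      using linear_sum[OF L] linear_scale[OF L]
      by (metis (mono_tags, lifting) euclidean_representation sum.cong)
    then have "norm (?D v) \<le> (\<Sum>u\<in>Basis. \<bar>v \<bullet> u\<bar> * norm (?D u))"
      by (metis (mono_tags, lifting) norm_scaleR norm_sum sum.cong)
    also have "\<dots> \<le> (\<Sum>u\<in>Basis. norm v * norm (?D u))"
      by (intro sum_mono mult_right_mono) (auto simp: Basis_le_norm)
    finally show ?thesis by (simp add: e_def sum_distrib_left mult.commute)
  qed
  \<comment> \<open>One more step multiplies the accumulated error by at most exp (C |h|) and adds
    one local error, at most \<open>e h * R\<close> on B.\<close>
  have path: "\<exists>c\<in>B. norm (lin_exp A (real k * h) b - c) \<le> real k * exp (C * \<bar>h\<bar>) ^ k * (e h * R)"
    if h: "\<bar>h\<bar> < \<delta>" for k h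
  proof (induction k)
    case 0 show ?case using B(2) by (auto intro!: bexI[of _ b])
  next
    case (Suc k)
    let ?E = "exp (C * \<bar>h\<bar>)" let ?u = "lin_exp A (real k * h) b"
    from Suc obtain c where c: "c \<in> B" "norm (?u - c) \<le> real k * ?E ^ k * (e h * R)" by blast
    have E: "1 \<le> ?E" using C(1) by simp
    have e: "e h \<ge> 0" by (simp add: e_def sum_nonneg)
    have "lin_exp A (real (Suc k) * h) b - M h c = lin_exp A h (?u - c) + (lin_exp A h c - M h c)"
      using lin_exp_add[of h "real k * h" b] by (simp add: linear_diff[OF linear_lin_exp] algebra_simps)
    also have "norm \<dots> \<le> norm (lin_exp A h (?u - c)) + norm (lin_exp A h c - M h c)"
      by (rule norm_triangle_ineq)
    also have "\<dots> \<le> ?E * (real k * ?E ^ k * (e h * R)) + e h * R"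
      using norm_lin_exp_le[OF C(2), of h "?u - c"] C(1) c(2) step[OF h, of c] R(2)[OF c(1)] e
      by (intro add_mono) (auto intro: order_trans mult_left_mono)
    also have "\<dots> \<le> ?E * (real k * ?E ^ k * (e h * R)) + ?E ^ Suc k * (e h * R)"
      using one_le_power[OF E, of "Suc k"] mult_right_mono[of 1 "?E ^ Suc k" "e h * R"] e R(1) by simp
    also have "\<dots> = real (Suc k) * ?E ^ Suc k * (e h * R)" by (simp add: algebra_simps)
    finally show ?case using M(2)[OF h] c(1) by blast
  qed
  define h where "h n = t / real (Suc n)" for n
  have h0: "h \<longlonglongrightarrow> 0" unfolding h_def
    by (rule LIMSEQ_Suc[OF lim_const_over_n])
  \<comment> \<open>The local error is o(h): both curves start at u and have the same derivative
    \<open>A u\<close> at 0.\<close>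
  have e0: "((\<lambda>h. e h / \<bar>h\<bar>) \<longlongrightarrow> 0) (at 0)"
  proof -
    have "((\<lambda>h. norm (lin_exp A h u - M h u) / \<bar>h\<bar>) \<longlongrightarrow> 0) (at 0)" for u
    proof -
      have "((\<lambda>h. lin_exp A h u - M h u) has_vector_derivative A u - A u) (at 0)"
        using lin_exp_has_vector_derivative[of u 0 UNIV] M'[of u] by (intro has_vector_derivative_diff) auto
      then show ?thesis
        unfolding has_vector_derivative_def has_derivative_at by (simp add: M0)
    qed
    then show ?thesis unfolding e_def sum_divide_distrib by (intro tendsto_null_sum) auto
  qed
  have "filterlim h (at 0) sequentially"
    using h0 False by (auto simp: filterlim_at h_def)
  from filterlim_compose[OF e0 this] have "(\<lambda>n. e (h n) / \<bar>h n\<bar>) \<longlonglongrightarrow> 0" .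
  then have lim: "(\<lambda>n. exp (C * \<bar>t\<bar>) * \<bar>t\<bar> * R * (e (h n) / \<bar>h n\<bar>)) \<longlonglongrightarrow> 0"
    by (rule tendsto_mult_right_zero)
  have ev: "\<forall>\<^sub>F n in sequentially. \<bar>h n\<bar> < \<delta>"
    using tendstoD[OF h0 \<open>\<delta> > 0\<close>] by (simp add: dist_real_def)
  have "\<forall>\<^sub>F n in sequentially. \<exists>c\<in>B. norm (lin_exp A t b - c) \<le> exp (C * \<bar>t\<bar>) * \<bar>t\<bar> * R * (e (h n) / \<bar>h n\<bar>)"
    using ev
  proof eventually_elim
    case (elim n)
    \<comment> \<open>\<open>Suc n\<close> steps of length \<open>h n\<close> reach time t, and
      their growth factors multiply to exp (C |t|) for every n; what is left is the local error
      divided by the step length.\<close>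
    have t: "real (Suc n) * h n = t" by (simp add: h_def)
    have "C * \<bar>t\<bar> = real (Suc n) * (C * \<bar>h n\<bar>)"
      unfolding h_def abs_divide by (simp add: field_simps del: of_nat_Suc)
    then have "exp (C * \<bar>h n\<bar>) ^ Suc n = exp (C * \<bar>t\<bar>)"
      by (simp only: exp_of_nat_mult)
    moreover have "real (Suc n) * X * (e (h n) * R) = X * \<bar>t\<bar> * R * (e (h n) / \<bar>h n\<bar>)" for X
    proof -
      have "real (Suc n) = \<bar>t\<bar> / \<bar>h n\<bar>"
        using False unfolding h_def abs_divide by (simp del: of_nat_Suc)
      then show ?thesis by simp
    qed
    ultimately have "real (Suc n) * exp (C * \<bar>h n\<bar>) ^ Suc n * (e (h n) * R)
        = exp (C * \<bar>t\<bar>) * \<bar>t\<bar> * R * (e (h n) / \<bar>h n\<bar>)" by (simp only:)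
    then show ?case using path[OF elim, of "Suc n"] unfolding t by (simp only:)
  qed
  note close = this
  have "\<exists>c\<in>B. dist c (lin_exp A t b) < \<epsilon>" if "\<epsilon> > 0" for \<epsilon>
  proof -
    have "\<forall>\<^sub>F n in sequentially. exp (C * \<bar>t\<bar>) * \<bar>t\<bar> * R * (e (h n) / \<bar>h n\<bar>) < \<epsilon>"
      using order_tendstoD(2)[OF lim that] .
    with close have "\<forall>\<^sub>F n in sequentially. \<exists>c\<in>B. dist c (lin_exp A t b) < \<epsilon>"
    proof eventually_elim
      case (elim n)
      then obtain c where "c \<in> B" "norm (lin_exp A t b - c) < \<epsilon>" by fastforce
      then show ?case by (auto simp: dist_norm norm_minus_commute)
    qed
    then show ?thesis using eventually_happens' sequentially_bot by blast
  qed
  then show ?thesis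
    using closed_approachable[OF compact_imp_closed[OF B(1)]] by blast
qed (use B in simp)

end

section \<open>Invariant forms\<close>

text \<open>An inner product independent of the ambient one. It covers the limit form of a single
  bounded flow and, later, minus the Killing form.\<close>

locale inner_form =
  fixes Q :: "'e::euclidean_space \<Rightarrow> 'e \<Rightarrow> real"
  assumes bilinear: "bilinear Q" and sym: "Q x y = Q y x" and pos: "x \<noteq> 0 \<Longrightarrow> Q x x > 0"
begin

lemmas form_simps = bilinear_ladd[OF bilinear] bilinear_radd[OF bilinear] bilinear_lmul[OF bilinear]
  bilinear_rmul[OF bilinear] bilinear_lneg[OF bilinear] bilinear_rneg[OF bilinear]
  bilinear_lsub[OF bilinear] bilinear_rsub[OF bilinear] bilinear_lzero[OF bilinear] bilinear_rzero[OF bilinear]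

lemma linear_left: "linear (\<lambda>x. Q x y)" and linear_right: "linear (Q x)"
  using bilinear unfolding bilinear_def by auto

lemma nonneg: "Q x x \<ge> 0"
  using pos[of x] form_simps(9) by (cases "x = 0") auto

lemma eq_0_iff [simp]: "Q x x = 0 \<longleftrightarrow> x = 0"
  using pos[of x] form_simps(9) by (cases "x = 0") auto

section \<open>Orthonormal systems and the trace\<close>

lemma orthonormal_component:
  assumes "finite C" "\<And>c d. c \<in> C \<Longrightarrow> d \<in> C \<Longrightarrow> Q c d = (if c = d then 1 else 0)" "d \<in> C"
  shows "Q (\<Sum>c\<in>C. a c *\<^sub>R c) d = a d"
proof -
  have "Q (\<Sum>c\<in>C. a c *\<^sub>R c) d = (\<Sum>c\<in>C. a c * Q c d)"
    by (simp add: linear_sum[OF linear_left] form_simps)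
  also have "\<dots> = (\<Sum>c\<in>C. if c = d then a c else 0)"
    using assms(2,3) by (intro sum.cong) auto
  finally show ?thesis using assms(1,3) by simp
qed

text \<open>One Gram-Schmidt step: the residual of b is orthogonal to C. If it vanishes, b already
  lies in the span; otherwise it is normalised and added.\<close>

lemma orthonormal_extend:
  assumes "finite C" "\<And>c d. c \<in> C \<Longrightarrow> d \<in> C \<Longrightarrow> Q c d = (if c = d then 1 else 0)"
  shows "\<exists>D. finite D \<and> (\<forall>c\<in>D. \<forall>d\<in>D. Q c d = (if c = d then 1 else 0)) \<and> span D = span (insert b C)"
proof -
  define r where "r = b - (\<Sum>c\<in>C. Q b c *\<^sub>R c)"
  have r: "Q r d = 0" if "d \<in> C" for d
    using orthonormal_component[OF assms that] by (simp add: r_def form_simps)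
  have b: "b = r + (\<Sum>c\<in>C. Q b c *\<^sub>R c)" by (simp add: r_def)
  show ?thesis
  proof (cases "r = 0")
    case True
    then have "b = (\<Sum>c\<in>C. Q b c *\<^sub>R c)" using b by simp
    also have "\<dots> \<in> span C" by (intro span_sum span_scale span_base)
    finally have "b \<in> span C" .
    then show ?thesis using assms by (intro exI[of _ C]) (simp add: span_redundant)
  next
    case False
    define e where "e = (1 / sqrt (Q r r)) *\<^sub>R r"
    have Qr: "Q r r > 0" using pos False .
    have e: "Q e e = 1" using False nonneg[of r] by (simp add: e_def form_simps power2_eq_square[symmetric] power_divide)
    have ed: "Q e d = 0" "Q d e = 0" if "d \<in> C" for d
      using r[OF that] sym[of d e] by (auto simp: e_def form_simps)
    have "r = sqrt (Q r r) *\<^sub>R e" using False by (simp add: e_def)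
    then have "r \<in> span (insert e C)" by (metis span_base span_scale insertI1)
    then have "b \<in> span (insert e C)"
      by (subst b) (auto intro!: span_add span_sum span_scale intro: span_base)
    then have "insert b C \<subseteq> span (insert e C)" by (auto intro: span_base)
    moreover have "e \<in> span (insert b C)"
      unfolding e_def r_def by (intro span_scale span_diff span_sum) (auto intro: span_base)
    then have "insert e C \<subseteq> span (insert b C)" by (auto intro: span_base)
    ultimately have "span (insert e C) = span (insert b C)" by (simp add: span_eq)
    moreover have "e \<notin> C" using ed e by force
    ultimately show ?thesis using assms e ed by (intro exI[of _ "insert e C"]) auto
  qed
qed

lemma orthonormal_basis:
  assumes "subspace S"
  obtains C where "finite C" "\<And>c d. c \<in> C \<Longrightarrow> d \<in> C \<Longrightarrow> Q c d = (if c = d then 1 else 0)"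
    "span C = S"
proof -
  have "\<exists>C. finite C \<and> (\<forall>c\<in>C. \<forall>d\<in>C. Q c d = (if c = d then 1 else 0)) \<and> span C = span B" if "finite B" for B
    using that
  proof induction
    case empty show ?case by (intro exI[of _ "{}"]) auto
  next
    case (insert b B)
    then obtain C where C: "finite C" "\<And>c d. c \<in> C \<Longrightarrow> d \<in> C \<Longrightarrow> Q c d = (if c = d then 1 else 0)" "span C = span B"
      by auto
    obtain D where D: "finite D" "\<forall>c\<in>D. \<forall>d\<in>D. Q c d = (if c = d then 1 else 0)" "span D = span (insert b C)"
      using orthonormal_extend[OF C(1,2), of b] by auto
    have "span D = span (insert b B)" using C(3) D(3) by (simp add: span_insert)
    then show ?case using D by (intro exI[of _ D]) auto
  qed
  moreover obtain B where "finite B" "span B = S" using basis_subspace_exists[OF assms] by metis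
  ultimately show ?thesis using that by metis
qed

text \<open>A vector of T outside S, minus its projection onto S, will do.\<close>

lemma orthogonal_vector_exists:
  assumes "subspace S" "subspace T" "S \<subseteq> T" "S \<noteq> T"
  obtains d where "d \<in> T" "d \<noteq> 0" "\<And>s. s \<in> S \<Longrightarrow> Q d s = 0"
proof -
  obtain x where x: "x \<in> T" "x \<notin> S" using assms by blast
  obtain C where C: "finite C" "\<And>c d. c \<in> C \<Longrightarrow> d \<in> C \<Longrightarrow> Q c d = (if c = d then 1 else 0)" "span C = S"
    using orthonormal_basis[OF assms(1)] by metis
  define y where "y = (\<Sum>c\<in>C. Q x c *\<^sub>R c)"
  have "y \<in> S" unfolding y_def C(3)[symmetric] by (intro span_sum span_scale span_base)
  moreover have "Q (x - y) s = 0" if "s \<in> S" for s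
  proof (rule linear_eq_0_on_span[OF linear_right])
    show "s \<in> span C" using C(3) that by simp
    show "Q (x - y) c = 0" if "c \<in> C" for c
      using orthonormal_component[OF C(1,2) that, of "Q x"] by (simp add: y_def form_simps)
  qed
  ultimately show ?thesis using x assms(2,3) by (intro that[of "x - y"]) (auto intro: subspace_diff)
qed

lemma orthonormal_expansion:
  assumes "finite C" "\<And>c d. c \<in> C \<Longrightarrow> d \<in> C \<Longrightarrow> Q c d = (if c = d then 1 else 0)" "span C = UNIV"
  shows "v = (\<Sum>c\<in>C. Q v c *\<^sub>R c)"
proof -
  define r where "r = v - (\<Sum>c\<in>C. Q v c *\<^sub>R c)"
  have "Q r d = 0" if "d \<in> C" for d
    using orthonormal_component[OF assms(1,2) that] by (simp add: r_def form_simps)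
  moreover have "r \<in> span C" using assms(3) by simp
  ultimately have "Q r r = 0"
    using linear_eq_0_on_span[OF linear_right, of C r r] by blast
  then show ?thesis by (simp add: r_def)
qed

text \<open>Expanding in both bases and exchanging the sums shows basis independence. It is needed
  because \<open>endo_trace\<close> uses the ambient \<open>Basis\<close>, while skewness refers to
  Q.\<close>

lemma endo_trace_orthonormal:
  assumes C: "finite C" "\<And>c d. c \<in> C \<Longrightarrow> d \<in> C \<Longrightarrow> Q c d = (if c = d then 1 else 0)" "span C = UNIV"
    and f: "linear f"
  shows "endo_trace f = (\<Sum>c\<in>C. Q (f c) c)"
proof -
  have "f b = (\<Sum>c\<in>C. Q b c *\<^sub>R f c)" for b
    using arg_cong[OF orthonormal_expansion[OF C, of b], of f] by (simp add: linear_sum[OF f] linear_scale[OF f])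
  then have "f b \<bullet> b = (\<Sum>c\<in>C. Q b c * (f c \<bullet> b))" for b
    by (metis (no_types, lifting) inner_scaleR_left inner_sum_left sum.cong)
  then have "endo_trace f = (\<Sum>b\<in>Basis. \<Sum>c\<in>C. Q b c * (f c \<bullet> b))" by (simp add: endo_trace_def)
  also have "\<dots> = (\<Sum>c\<in>C. \<Sum>b\<in>Basis. (f c \<bullet> b) * Q b c)" by (subst sum.swap) (simp add: mult.commute)
  also have "\<dots> = (\<Sum>c\<in>C. Q (f c) c)"
  proof (rule sum.cong)
    fix c
    have "Q (f c) c = Q (\<Sum>b\<in>Basis. (f c \<bullet> b) *\<^sub>R b) c" by (simp add: euclidean_representation)
    then show "(\<Sum>b\<in>Basis. (f c \<bullet> b) * Q b c) = Q (f c) c"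
      by (simp only: linear_sum[OF linear_left] form_simps real_scaleR_def)
  qed simp
  finally show ?thesis .
qed

text \<open>In a Q-orthonormal basis skewness turns the trace of the square into minus the sum of
  the squared lengths \<open>Q (A c) (A c)\<close>.\<close>

lemma endo_trace_skew_square:
  assumes A: "linear A" and skew: "\<And>u v. Q (A u) v = - Q u (A v)"
  shows "endo_trace (A \<circ> A) \<le> 0" "endo_trace (A \<circ> A) = 0 \<Longrightarrow> A v = 0"
proof -
  obtain C where C: "finite C" "\<And>c d. c \<in> C \<Longrightarrow> d \<in> C \<Longrightarrow> Q c d = (if c = d then 1 else 0)" "span C = UNIV"
    using orthonormal_basis[OF subspace_UNIV] by metis
  have tr: "endo_trace (A \<circ> A) = - (\<Sum>c\<in>C. Q (A c) (A c))"
    using endo_trace_orthonormal[OF C linear_compose[OF A A]] by (simp add: skew sum_negf)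
  then show "endo_trace (A \<circ> A) \<le> 0" by (simp add: sum_nonneg nonneg)
  assume "endo_trace (A \<circ> A) = 0"
  with tr have "\<forall>c\<in>C. A c = 0" by (simp add: sum_nonneg_eq_0_iff[OF C(1)] nonneg)
  then show "A v = 0" using linear_eq_0_on_span[OF A, of C v] C(3) by blast
qed

end

text \<open>The invariant form is a limit point of the averages of the ambient inner product along the
  flow over \<open>[0, n]\<close>: the averages are skew up to the error
  \<open>(lin_exp A n u \<bullet> lin_exp A n v - u \<bullet> v) / n\<close>.\<close>

lemma bounded_flow_invariant_form:
  assumes A: "linear A" and bnd: "\<And>t v. norm (lin_exp A t v) \<le> C * norm v"
  obtains Q where "inner_form Q" "\<And>u v. Q (A u) v = - Q u (A v)"
proof -
  let ?F = "lin_exp A"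
  note LF = linear_lin_exp[OF A]
  define I where "I n u v = integral {0..real (Suc n)} (\<lambda>t. ?F t u \<bullet> ?F t v) / real (Suc n)" for n u v
  have cont: "continuous_on S (\<lambda>t. ?F t v)" for v S
    using lin_exp_has_vector_derivative[OF A] by (meson continuous_on_vector_derivative)
  have int: "(\<lambda>t. ?F t u \<bullet> ?F t v) integrable_on {0..r}" for u v r
    by (intro integrable_continuous_real continuous_on_inner cont)
  have Iadd: "I n (u + u') v = I n u v + I n u' v" for n u u' v
    by (simp add: I_def linear_add[OF LF] inner_add_left integral_add[OF int int] add_divide_distrib)
  have Isc: "I n (c *\<^sub>R u) v = c * I n u v" for n c u v
    by (simp add: I_def linear_scale[OF LF])
  have Isym: "I n u v = I n v u" for n u v by (simp add: I_def inner_commute)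
  \<comment> \<open>The bound at time 0, where the flow is the identity, on a basis vector.\<close>
  have C: "C \<ge> 1"
  proof -
    obtain b :: 'a where "b \<in> Basis" using nonempty_Basis by blast
    then show ?thesis using bnd[of 0 b] A by simp
  qed
  have le: "\<bar>?F t u \<bullet> ?F t v\<bar> \<le> C\<^sup>2 * norm u * norm v" for t u v
  proof -
    have "\<bar>?F t u \<bullet> ?F t v\<bar> \<le> norm (?F t u) * norm (?F t v)" by (rule Cauchy_Schwarz_ineq2)
    also have "\<dots> \<le> (C * norm u) * (C * norm v)" using C by (intro mult_mono bnd) auto
    finally show ?thesis by (simp add: power2_eq_square mult_ac)
  qed
  have Ile: "\<bar>I n u v\<bar> \<le> C\<^sup>2 * norm u * norm v" for n u v
  proof -
    have "norm (?F t u \<bullet> ?F t v) \<le> C\<^sup>2 * norm u * norm v" for t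
      using le by simp
    then have "norm (integral (cbox 0 (real (Suc n))) (\<lambda>t. ?F t u \<bullet> ?F t v))
        \<le> C\<^sup>2 * norm u * norm v * measure lborel (cbox 0 (real (Suc n)))"
      using int[of u v] by (intro integrable_bound) auto
    then show ?thesis by (simp add: I_def abs_divide field_simps del: of_nat_Suc)
  qed
  have Ige: "I n u u \<ge> (norm u)\<^sup>2 / C\<^sup>2" for n u
  proof -
    have "(norm u)\<^sup>2 / C\<^sup>2 \<le> ?F t u \<bullet> ?F t u" for t
    proof -
      \<comment> \<open>The bound for time -t, applied to \<open>?F t u\<close>, bounds the flow
        from below; this keeps the averages uniformly positive definite.\<close>
      have "norm u \<le> C * norm (?F t u)" using bnd[of "-t" "?F t u"] by (simp add: lin_exp_minus[OF A])
      then have "(norm u)\<^sup>2 \<le> (C * norm (?F t u))\<^sup>2" by (intro power_mono) auto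
      then show ?thesis using C by (simp add: field_simps power2_norm_eq_inner[symmetric] power_mult_distrib)
    qed
    then have "integral {0..real (Suc n)} (\<lambda>t. (norm u)\<^sup>2 / C\<^sup>2) \<le> integral {0..real (Suc n)} (\<lambda>t. ?F t u \<bullet> ?F t u)"
      by (intro integral_le int) auto
    then show ?thesis by (simp add: I_def field_simps del: of_nat_Suc)
  qed
  have Iskew: "I n (A u) v + I n u (A v) = (?F (real (Suc n)) u \<bullet> ?F (real (Suc n)) v - u \<bullet> v) / real (Suc n)" for n u v
  proof -
    let ?f = "\<lambda>t. ?F t u \<bullet> ?F t v"
    have "(?f has_vector_derivative (?F t (A u) \<bullet> ?F t v + ?F t u \<bullet> ?F t (A v))) (at t within {0..real (Suc n)})" for t
      using bounded_bilinear.has_vector_derivative[OF bounded_bilinear_inner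
          lin_exp_has_vector_derivative[OF A, of u] lin_exp_has_vector_derivative[OF A, of v]]
      by (simp add: lin_exp_commute[OF A] add.commute)
    then have "((\<lambda>t. ?F t (A u) \<bullet> ?F t v + ?F t u \<bullet> ?F t (A v)) has_integral (?f (real (Suc n)) - ?f 0)) {0..real (Suc n)}"
      by (intro fundamental_theorem_of_calculus) auto
    from integral_unique[OF this] show ?thesis
      unfolding I_def integral_add[OF int int]
      by (simp add: add_divide_distrib[symmetric] lin_exp_0[OF A] del: of_nat_Suc)
  qed
  \<comment> \<open>The operator representing the form \<open>I n\<close>. These operators are
    uniformly bounded on a finite-dimensional space, so a subsequence converges.\<close>
  define S where "S n = Blinfun (\<lambda>u. \<Sum>b\<in>Basis. I n u b *\<^sub>R b)" for n
  have Iright: "I n u (v + v') = I n u v + I n u v'" "I n u (c *\<^sub>R v) = c * I n u v" for n c u v v'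
    using Iadd Isc Isym by metis+
  have linS: "linear (\<lambda>u. \<Sum>b\<in>Basis. I n u b *\<^sub>R b)" for n
    by (rule linearI) (simp_all add: Iadd Isc scaleR_add_left sum.distrib scaleR_sum_right)
  have S: "blinfun_apply (S n) u = (\<Sum>b\<in>Basis. I n u b *\<^sub>R b)" for n u
    unfolding S_def using linS[of n] by (subst bounded_linear_Blinfun_apply) (simp_all add: linear_conv_bounded_linear)
  have SI: "S n u \<bullet> v = I n u v" for n u v
  proof -
    have "I n u v = I n u (\<Sum>b\<in>Basis. (v \<bullet> b) *\<^sub>R b)" by (simp add: euclidean_representation)
    also have "\<dots> = (\<Sum>b\<in>Basis. (v \<bullet> b) * I n u b)"
    proof -
      have "linear (I n u)" by (rule linearI) (simp_all add: Iright)
      then show ?thesis by (simp only: linear_sum Iright)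
    qed
    also have "\<dots> = S n u \<bullet> v"
      by (simp add: S inner_sum_left inner_commute[of v] mult.commute)
    finally show ?thesis ..
  qed
  have "norm (S n) \<le> C\<^sup>2" for n
  proof (rule norm_blinfun_bound)
    fix u
    have "norm (S n u) * norm (S n u) \<le> C\<^sup>2 * norm u * norm (S n u)"
      using Ile[of n u "S n u"] SI[of n u "S n u"] by (simp add: power2_norm_eq_inner[symmetric] power2_eq_square)
    then show "norm (S n u) \<le> C\<^sup>2 * norm u" using C by (cases "S n u = 0") auto
  qed simp
  then have "bounded (range S)" by (auto simp: bounded_iff)
  then obtain l r where lr: "strict_mono r" "(S \<circ> r) \<longlonglongrightarrow> l"
    using bounded_imp_convergent_subsequence by blast
  define Q where "Q u v = l u \<bullet> v" for u v
  have lim: "(\<lambda>n. I (r n) u v) \<longlonglongrightarrow> Q u v" for u v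
  proof -
    have "(\<lambda>n. S (r n)) \<longlonglongrightarrow> l" using lr(2) by (simp only: o_def)
    then have "(\<lambda>n. S (r n) u) \<longlonglongrightarrow> l u" by (intro tendsto_intros)
    then show ?thesis unfolding Q_def SI[symmetric] by (rule tendsto_inner[OF _ tendsto_const])
  qed
  have Qsym: "Q u v = Q v u" for u v
    using LIMSEQ_unique[OF lim[of u v]] lim[of v u] Isym by simp
  have "bilinear Q" unfolding bilinear_def Q_def
    by (auto intro!: linearI simp: blinfun.add_right blinfun.scaleR_right inner_add_left inner_add_right)
  moreover have "Q u u > 0" if "u \<noteq> 0" for u
  proof -
    have "(norm u)\<^sup>2 / C\<^sup>2 \<le> Q u u" using Ige by (intro LIMSEQ_le_const[OF lim]) auto
    moreover have "(norm u)\<^sup>2 / C\<^sup>2 > 0" using C that by simp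
    ultimately show ?thesis by linarith
  qed
  ultimately have "inner_form Q" using Qsym by (intro inner_form.intro) auto
  moreover have "Q (A u) v = - Q u (A v)" for u v
  proof -
    have "(\<lambda>n. (?F (real (Suc n)) u \<bullet> ?F (real (Suc n)) v - u \<bullet> v) / real (Suc n)) \<longlonglongrightarrow> 0"
    proof (rule Lim_null_comparison)
      show "(\<lambda>n. (2 * (C\<^sup>2 * norm u * norm v)) / real (Suc n)) \<longlonglongrightarrow> 0"
        by (rule LIMSEQ_Suc[OF lim_const_over_n])
      have le': "\<bar>?F t u \<bullet> ?F t v - u \<bullet> v\<bar> \<le> 2 * (C\<^sup>2 * norm u * norm v)" for t
      proof -
        have "\<bar>u \<bullet> v\<bar> \<le> C\<^sup>2 * norm u * norm v" using le[of 0 u v] by (simp only: lin_exp_0[OF A])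
        then show ?thesis using abs_triangle_ineq4[of "?F t u \<bullet> ?F t v" "u \<bullet> v"] le[of t u v] by linarith
      qed
      then show "\<forall>\<^sub>F n in sequentially. norm ((?F (real (Suc n)) u \<bullet> ?F (real (Suc n)) v - u \<bullet> v) / real (Suc n))
          \<le> (2 * (C\<^sup>2 * norm u * norm v)) / real (Suc n)"
        unfolding real_norm_def abs_divide
        by (intro always_eventually allI) (simp add: divide_right_mono[OF le'] del: of_nat_Suc)
    qed
    from LIMSEQ_subseq_LIMSEQ[OF this lr(1)]
    have "(\<lambda>n. I (r n) (A u) v + I (r n) u (A v)) \<longlonglongrightarrow> 0" by (simp add: Iskew o_def)
    moreover have "(\<lambda>n. I (r n) (A u) v + I (r n) u (A v)) \<longlonglongrightarrow> Q (A u) v + Q u (A v)"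
      by (intro tendsto_add lim)
    ultimately show ?thesis using LIMSEQ_unique by fastforce
  qed
  ultimately show ?thesis by (rule that)
qed

lemma endo_trace_bounded_flow:
  assumes A: "linear A" and "\<And>t v. norm (lin_exp A t v) \<le> C * norm v"
  shows "endo_trace (A \<circ> A) \<le> 0" "endo_trace (A \<circ> A) = 0 \<Longrightarrow> A v = 0"
proof -
  obtain Q where "inner_form Q" "\<And>u v. Q (A u) v = - Q u (A v)"
    using bounded_flow_invariant_form[OF assms] by blast
  then show "endo_trace (A \<circ> A) \<le> 0" "endo_trace (A \<circ> A) = 0 \<Longrightarrow> A v = 0"
    using inner_form.endo_trace_skew_square[OF _ A] by blast+
qed

text \<open>The minimum of Q on the compact unit sphere, extended by homogeneity. It converts bounds
  in the form into bounds in the ambient norm.\<close>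

lemma (in inner_form) coercive:
  "\<exists>m>0. \<forall>u. m * (norm u)\<^sup>2 \<le> Q u u"
proof -
  obtain b :: 'e where "b \<in> Basis" using nonempty_Basis by blast
  then have ne: "sphere (0::'e) 1 \<noteq> {}" by (auto intro!: exI[of _ b])
  have cont: "continuous_on (sphere 0 1) (\<lambda>u. Q u u)"
    by (intro bilinear_continuous_on_compose[OF _ _ bilinear] continuous_on_id)
  obtain s where s: "s \<in> sphere 0 1" "\<And>u. u \<in> sphere 0 1 \<Longrightarrow> Q s s \<le> Q u u"
    using continuous_attains_inf[OF compact_sphere ne cont] by blast
  have "Q s s * (norm u)\<^sup>2 \<le> Q u u" for u
  proof (cases "u = 0")
    case False
    then have "Q s s \<le> Q ((1 / norm u) *\<^sub>R u) ((1 / norm u) *\<^sub>R u)" by (intro s(2)) simp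
    also have "\<dots> = Q u u / (norm u)\<^sup>2" by (simp add: form_simps power2_eq_square)
    finally show ?thesis using False by (simp add: field_simps)
  qed (simp add: form_simps)
  moreover have "Q s s > 0" using s(1) pos[of s] by fastforce
  ultimately show ?thesis by blast
qed

section \<open>Algebraic rules for the trace\<close>

lemma endo_trace_comp_commute:
  fixes f g :: "'e::euclidean_space \<Rightarrow> 'e"
  assumes f: "linear f" and g: "linear g"
  shows "endo_trace (f \<circ> g) = endo_trace (g \<circ> f)"
proof -
  have "endo_trace (f \<circ> g) = (\<Sum>b\<in>Basis. \<Sum>c\<in>Basis. (g b \<bullet> c) * (f c \<bullet> b))" if f: "linear f" for f g :: "'e \<Rightarrow> 'e"
  proof -
    have "f (g b) \<bullet> b = f (\<Sum>c\<in>Basis. (g b \<bullet> c) *\<^sub>R c) \<bullet> b" for b by (simp add: euclidean_representation)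
    then show ?thesis by (simp add: endo_trace_def linear_sum[OF f] linear_scale[OF f] inner_sum_left)
  qed
  note tr = this[OF f, of g] this[OF g, of f]
  show ?thesis unfolding tr by (subst sum.swap) (simp add: mult.commute)
qed

lemma endo_trace_add: "endo_trace (\<lambda>v. f v + g v) = endo_trace f + endo_trace g"
  and endo_trace_diff: "endo_trace (\<lambda>v. f v - g v) = endo_trace f - endo_trace g"
  and endo_trace_scaleR: "endo_trace (\<lambda>v. c *\<^sub>R f v) = c * endo_trace f"
  by (simp_all add: endo_trace_def inner_add_left inner_diff_left sum.distrib sum_subtractf sum_distrib_left)

section \<open>Invariant bodies in a Lie algebra\<close>

text \<open>The Jacobi identity is stated as the derivation rule for \<open>br x\<close>, the shape
  in which it is used along flows.\<close>

locale lie_algebra =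
  fixes br :: "'e::euclidean_space \<Rightarrow> 'e \<Rightarrow> 'e"
  assumes bilinear_br: "bilinear br" and skew_br: "br x y = - br y x"
    and jacobi: "br x (br y z) = br (br x y) z + br y (br x z)"
begin

lemmas br_simps = bilinear_ladd[OF bilinear_br] bilinear_radd[OF bilinear_br]
  bilinear_lmul[OF bilinear_br] bilinear_rmul[OF bilinear_br] bilinear_lneg[OF bilinear_br]
  bilinear_rneg[OF bilinear_br] bilinear_lsub[OF bilinear_br] bilinear_rsub[OF bilinear_br]
  bilinear_lzero[OF bilinear_br] bilinear_rzero[OF bilinear_br]

lemma linear_br: "linear (br x)" and linear_br_left: "linear (\<lambda>x. br x y)"
  using bilinear_br unfolding bilinear_def by auto

lemma br_eq_0_commute: "br x y = 0 \<longleftrightarrow> br y x = 0"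
  using skew_br[of x y] by simp

section \<open>The Killing form and the flows of inner derivations\<close>

lemma neg_killing_commute: "neg_killing br x y = neg_killing br y x"
  using endo_trace_comp_commute[OF linear_br linear_br] by (simp add: neg_killing_def killing_form_def)

lemma bilinear_neg_killing: "bilinear (neg_killing br)"
proof -
  have "linear (neg_killing br x)" for x
    by (rule linearI) (simp_all add: neg_killing_def killing_form_def o_def br_simps endo_trace_add endo_trace_scaleR)
  moreover have "(\<lambda>x. neg_killing br x y) = neg_killing br y" for y
    by (rule ext) (rule neg_killing_commute)
  ultimately show ?thesis by (simp add: bilinear_def)
qed

text \<open>By Jacobi, \<open>br (br z x)\<close> is the commutator of \<open>br z\<close> and
  \<open>br x\<close>; after expanding both sides the remaining traces agree by cyclicity.\<close>

lemma neg_killing_invariant: "neg_killing br (br z x) y = - neg_killing br x (br z y)"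
proof -
  have L: "linear (\<lambda>v. br x (br y v))" for x y
    using linear_compose[OF linear_br[of y] linear_br[of x]] by (simp add: o_def)
  have c: "br (br z x) v = br z (br x v) - br x (br z v)" for z x v
    using jacobi[of z x v] by simp
  have "killing_form br (br z x) y = endo_trace (\<lambda>v. br z (br x (br y v))) - endo_trace (\<lambda>v. br x (br z (br y v)))"
    by (simp add: killing_form_def o_def c endo_trace_diff)
  moreover have "killing_form br x (br z y) = endo_trace (\<lambda>v. br x (br z (br y v))) - endo_trace (\<lambda>v. br x (br y (br z v)))"
    by (simp add: killing_form_def o_def c br_simps endo_trace_diff)
  moreover have "endo_trace (\<lambda>v. br z (br x (br y v))) = endo_trace (\<lambda>v. br x (br y (br z v)))"
    using endo_trace_comp_commute[OF linear_br L, of z x y] by (simp add: o_def)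
  ultimately show ?thesis by (simp add: neg_killing_def)
qed

text \<open>Both sides solve the flow equation of \<open>br Y\<close> with value
  \<open>br u v\<close> at time 0, since \<open>br Y\<close> is a derivation.\<close>

lemma lin_exp_br:
  "lin_exp (br Y) t (br u v) = br (lin_exp (br Y) t u) (lin_exp (br Y) t v)"
proof -
  let ?F = "lin_exp (br Y)"
  interpret bounded_bilinear br using bilinear_br by (simp add: bilinear_conv_bounded_bilinear)
  have "((\<lambda>t. br (?F t u) (?F t v)) has_vector_derivative br Y (br (?F t u) (?F t v))) (at t)" for t
    using has_vector_derivative[OF lin_exp_has_vector_derivative[OF linear_br[of Y], of u t UNIV]
        lin_exp_has_vector_derivative[OF linear_br[of Y], of v t UNIV]]
    by (simp add: jacobi[of Y "?F t u" "?F t v"] add.commute)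
  from lin_exp_unique[OF linear_br this] show ?thesis by (simp add: lin_exp_0[OF linear_br])
qed

lemma lin_exp_fixed: "br Y p = 0 \<Longrightarrow> lin_exp (br Y) t p = p"
  using lin_exp_unique[OF linear_br, of "\<lambda>_. p" Y t] by simp

lemma lin_exp_fixed_imp:
  assumes "\<And>t. lin_exp (br Y) t p = p"
  shows "br Y p = 0"
proof -
  have "((\<lambda>t. p) has_vector_derivative br Y p) (at 0)"
    using lin_exp_has_vector_derivative[OF linear_br, of Y p 0 UNIV] by (simp add: assms)
  then show ?thesis using vector_derivative_unique_at has_vector_derivative_const by blast
qed

text \<open>By \<open>neg_killing_invariant\<close> the two terms of the product rule cancel, so the
  value stays that of time 0.\<close>

lemma lin_exp_neg_killing:
  "neg_killing br (lin_exp (br Y) t u) (lin_exp (br Y) t v) = neg_killing br u v"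
proof -
  let ?F = "lin_exp (br Y)" let ?f = "\<lambda>t. neg_killing br (?F t u) (?F t v)"
  interpret bounded_bilinear "neg_killing br"
    using bilinear_neg_killing by (simp add: bilinear_conv_bounded_bilinear)
  have "(?f has_vector_derivative 0) (at t)" for t
    using has_vector_derivative[OF lin_exp_has_vector_derivative[OF linear_br[of Y], of u t UNIV]
        lin_exp_has_vector_derivative[OF linear_br[of Y], of v t UNIV]]
    by (simp add: neg_killing_invariant)
  then have "?f t = ?f 0"
    using has_vector_derivative_zero_constant[of UNIV ?f] by (metis UNIV_I convex_UNIV)
  then show ?thesis by (simp add: lin_exp_0[OF linear_br])
qed

text \<open>Time 0 is a maximum, and the derivative there is \<open>f (br Y v)\<close>. In the
  maximality arguments below, Y is chosen so that this is the squared length of a bracket.\<close>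

lemma lin_exp_stationary:
  assumes f: "linear (f :: 'e \<Rightarrow> real)" and max: "\<And>t. f (lin_exp (br Y) t v) \<le> f v"
  shows "f (br Y v) = 0"
proof -
  have "((\<lambda>t. f (lin_exp (br Y) t v)) has_vector_derivative f (br Y (lin_exp (br Y) 0 v))) (at 0)"
    using f lin_exp_has_vector_derivative[OF linear_br]
    unfolding linear_conv_bounded_linear by (rule bounded_linear.has_vector_derivative)
  then have "((\<lambda>t. f (lin_exp (br Y) t v)) has_real_derivative f (br Y v)) (at 0)"
    by (simp add: has_real_derivative_iff_has_vector_derivative lin_exp_0[OF linear_br])
  then show ?thesis
    by (rule DERIV_local_max[where d = 1]) (use max in \<open>auto simp: lin_exp_0[OF linear_br]\<close>)
qed

text \<open>The centre is an ideal whose derived algebra is zero, so it is solvable.\<close>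

lemma center_trivial:
  assumes "lie_semisimple br" "\<And>y. br x y = 0"
  shows "x = 0"
proof -
  let ?Z = "{x. \<forall>y. br x y = 0}"
  have "lie_ideal br ?Z"
    unfolding lie_ideal_def subspace_def by (auto simp: br_simps) (metis br_eq_0_commute br_simps(9))
  moreover have "lie_solvable br ?Z"
    unfolding lie_solvable_def
  proof (intro exI[of _ 1])
    have "{br x y | x y. x \<in> ?Z \<and> y \<in> ?Z} = {0}" by (auto simp: br_simps intro!: exI[of _ 0])
    then show "derived_series br ?Z 1 = {0}" by (simp add: bracket_span_def)
  qed
  ultimately have "?Z = {0}" using assms(1) unfolding lie_semisimple_def by blast
  then show ?thesis using assms(2) by blast
qed

end

section \<open>Convex bodies invariant under all flows\<close>

locale invariant_body = lie_algebra br for br :: "'e::euclidean_space \<Rightarrow> 'e \<Rightarrow> 'e" +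
  fixes B :: "'e set"
  assumes semisimple: "lie_semisimple br" and body: "convex_body B" and zero_mem: "0 \<in> B"
    and flow_mem: "b \<in> B \<Longrightarrow> lin_exp (br Y) t b \<in> B"
begin

abbreviation form :: "'e \<Rightarrow> 'e \<Rightarrow> real" where "form \<equiv> neg_killing br"

lemma body_facts: "compact B" "convex B" "closed B"
  using body compact_imp_closed unfolding convex_body_def by auto

lemma interior_ball: "\<exists>\<epsilon>>0. \<exists>b. \<forall>u. norm u \<le> \<epsilon> \<longrightarrow> b + u \<in> B"
proof -
  obtain b where "b \<in> interior B" using body unfolding convex_body_def by blast
  then obtain \<epsilon> where "\<epsilon> > 0" "cball b \<epsilon> \<subseteq> B" using mem_interior_cball by blast
  then show ?thesis by (intro exI[of _ \<epsilon>] conjI exI[of _ b]) (auto simp: subset_eq dist_norm)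
qed

text \<open>A small vector is a difference of two points of B, and both stay in B under the flow;
  rescaling gives one constant for all Y and t.\<close>

lemma flow_bounded: "\<exists>C. \<forall>Y t v. norm (lin_exp (br Y) t v) \<le> C * norm v"
proof -
  obtain b \<epsilon> where b: "\<epsilon> > 0" "\<And>u. norm u \<le> \<epsilon> \<Longrightarrow> b + u \<in> B" using interior_ball by blast
  obtain R where R: "\<And>v. v \<in> B \<Longrightarrow> norm v \<le> R"
    using compact_imp_bounded[OF body_facts(1)] by (auto simp: bounded_iff)
  have "norm (lin_exp (br Y) t v) \<le> (2 * R / \<epsilon>) * norm v" for Y t v
  proof (cases "v = 0")
    case False
    let ?F = "lin_exp (br Y) t" note L = linear_lin_exp[OF linear_br, of Y t]
    define u where "u = (\<epsilon> / norm v) *\<^sub>R v"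
    have "norm u \<le> \<epsilon>" using b(1) False by (simp add: u_def)
    then have "norm (?F (b + u)) \<le> R" "norm (?F (b + 0)) \<le> R"
      using b by (auto intro!: R flow_mem simp del: add_0_right)
    moreover have "?F u = ?F (b + u) - ?F (b + 0)" by (simp add: linear_add[OF L])
    ultimately have "norm (?F u) \<le> 2 * R" using norm_triangle_ineq4[of "?F (b + u)" "?F (b + 0)"] by simp
    then have "\<epsilon> / norm v * norm (?F v) \<le> 2 * R" using b(1) by (simp add: u_def linear_scale[OF L])
    then show ?thesis using b(1) False by (simp add: field_simps)
  qed (simp add: linear_0[OF linear_lin_exp[OF linear_br]])
  then show ?thesis by blast
qed

sublocale inner_form form
proof
  show "bilinear form" by (rule bilinear_neg_killing)
  show "form x y = form y x" for x y by (rule neg_killing_commute)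
  show "form x x > 0" if "x \<noteq> 0" for x
  proof -
    obtain C where C: "\<And>Y t v. norm (lin_exp (br Y) t v) \<le> C * norm v" using flow_bounded by blast
    note tr = endo_trace_bounded_flow[OF linear_br C]
    \<comment> \<open>Trace 0 would force \<open>br x = 0\<close>, making x central.\<close>
    have "endo_trace (br x \<circ> br x) \<noteq> 0" using tr(2) center_trivial[OF semisimple] that by blast
    then show ?thesis using tr(1)[of x] by (simp add: neg_killing_def killing_form_def)
  qed
qed

lemma form_br_left: "form (br x y) z = form x (br y z)"
  using neg_killing_invariant[of y x z] skew_br[of x y] by (simp add: form_simps)

text \<open>Upgrades \<open>0 \<in> B\<close>. Let D be the set of centres of form-balls of a fixed
  radius contained in B. It is compact, and a shortest point of D is fixed by every flow, hence
  central, hence 0.\<close>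

lemma zero_interior: "\<exists>r>0. \<forall>u. form u u \<le> r \<longrightarrow> u \<in> B"
proof -
  obtain b \<epsilon> where b: "\<epsilon> > 0" "\<And>u. norm u \<le> \<epsilon> \<Longrightarrow> b + u \<in> B" using interior_ball by blast
  obtain m where m: "m > 0" "\<And>u. m * (norm u)\<^sup>2 \<le> form u u" using coercive by blast
  define r where "r = m * \<epsilon>\<^sup>2"
  have r: "r > 0" using m b by (simp add: r_def)
  define D where "D = {y. \<forall>u. form u u \<le> r \<longrightarrow> y + u \<in> B}"
  have "b + u \<in> B" if "form u u \<le> r" for u
  proof -
    have "(norm u)\<^sup>2 \<le> \<epsilon>\<^sup>2" using order_trans[OF m(2) that] m(1) by (simp add: r_def)
    then show ?thesis using b by (auto intro: power2_le_imp_le)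
  qed
  then have "b \<in> D" by (simp add: D_def)
  have "D = (\<Inter>u\<in>{u. form u u \<le> r}. (\<lambda>y. y + u) -` B)" by (auto simp: D_def)
  then have "closed D"
    by (auto intro!: closed_INT continuous_closed_vimage body_facts continuous_intros)
  moreover have "D \<subseteq> B" using r by (auto simp: D_def form_simps dest: spec[of _ 0])
  ultimately have "compact D" using closed_Int_compact[OF _ body_facts(1), of D] by (simp add: Int_absorb2)
  moreover have "continuous_on D (\<lambda>u. form u u)"
    by (intro bilinear_continuous_on_compose[OF _ _ bilinear] continuous_on_id)
  ultimately obtain y where y: "y \<in> D" "\<And>z. z \<in> D \<Longrightarrow> form y y \<le> form z z"
    using continuous_attains_inf[of D] \<open>b \<in> D\<close> by blast
  have "lin_exp (br Y) t y = y" for Y t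
  proof -
    let ?F = "lin_exp (br Y)" let ?z = "?F t y" let ?m = "(1/2) *\<^sub>R y + (1/2) *\<^sub>R ?z"
    have zD: "?z + u \<in> B" if "form u u \<le> r" for u
    proof -
      have "form (?F (-t) u) (?F (-t) u) \<le> r" using that lin_exp_neg_killing by simp
      then have "?F t (y + ?F (-t) u) \<in> B" using y(1) by (intro flow_mem) (auto simp: D_def)
      then show ?thesis by (simp add: linear_add[OF linear_lin_exp[OF linear_br]] lin_exp_minus[OF linear_br])
    qed
    have "?m \<in> D"
      unfolding D_def
    proof (intro CollectI allI impI)
      fix u assume u: "form u u \<le> r"
      have "(1/2) *\<^sub>R (y + u) + (1/2) *\<^sub>R (?z + u) \<in> B"
        using y(1) u zD by (intro convexD[OF body_facts(2)]) (auto simp: D_def)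
      also have "(1/2) *\<^sub>R (y + u) + (1/2) *\<^sub>R (?z + u) = ?m + ((1/2) *\<^sub>R u + (1/2) *\<^sub>R u)"
        by (simp only: scaleR_add_right ac_simps)
      also have "(1/2) *\<^sub>R u + (1/2) *\<^sub>R u = u" by (simp add: scaleR_add_left[symmetric])
      finally show "?m + u \<in> B" .
    qed
    from y(2)[OF this] have "form y y \<le> form ?m ?m" .
    moreover have "form ?m ?m = (form y y + form y ?z) / 2"
      by (simp add: form_simps lin_exp_neg_killing sym[of ?z y] field_simps)
    \<comment> \<open>If y and its equally long image \<open>?z\<close> differed, their midpoint in
      D would be strictly shorter.\<close>
    moreover have "form (y - ?z) (y - ?z) = 2 * (form y y - form y ?z)"
      by (simp add: form_simps lin_exp_neg_killing sym[of ?z y])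
    ultimately have "form (y - ?z) (y - ?z) \<le> 0" by simp
    then show ?thesis using nonneg[of "y - ?z"] eq_0_iff[of "y - ?z"] by simp
  qed
  then have "br Y y = 0" for Y by (rule lin_exp_fixed_imp)
  then have "y = 0" using center_trivial[OF semisimple] br_eq_0_commute by blast
  with y(1) r show ?thesis by (auto simp: D_def)
qed

lemma exposed_face_nonempty: "exposed_face br B x \<noteq> {}"
proof -
  have "continuous_on B (\<lambda>v. form v x)"
    using linear_left linear_continuous_on linear_conv_bounded_linear by blast
  then show ?thesis
    using continuous_attains_sup[OF body_facts(1), of "\<lambda>v. form v x"] zero_mem
    unfolding exposed_face_def by blast
qed

lemma compact_exposed_face: "compact (exposed_face br B x)"
proof -
  have "closed {v. form u x \<le> form v x}" for u
    using linear_left linear_continuous_on linear_conv_bounded_linear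
    by (intro closed_Collect_le continuous_on_const) blast
  then have "closed (\<Inter>u\<in>B. {v. form u x \<le> form v x})" by blast
  moreover have "exposed_face br B x = B \<inter> (\<Inter>u\<in>B. {v. form u x \<le> form v x})"
    by (auto simp: exposed_face_def)
  ultimately show ?thesis using body_facts(1) by (simp add: compact_Int_closed)
qed

section \<open>Faces and centralizers\<close>

lemma exposed_face_commutes:
  assumes "v \<in> exposed_face br B p"
  shows "br v p = 0"
proof -
  have "form (br Y v) p = 0" for Y
    using assms flow_mem by (intro lin_exp_stationary linear_left) (auto simp: exposed_face_def)
  \<comment> \<open>For \<open>Y = br v p\<close> the vanishing derivative is the squared length of
    \<open>br v p\<close>.\<close>
  from this[of "br v p"] show ?thesis using form_br_left[of "br v p" v p] by simp
qed

lemma exposed_face_flow: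
  assumes "br Y p = 0" "v \<in> exposed_face br B p"
  shows "lin_exp (br Y) t v \<in> exposed_face br B p"
proof -
  have "form (lin_exp (br Y) t v) p = form v p"
    using lin_exp_neg_killing[of Y t v p] lin_exp_fixed[OF assms(1)] by simp
  then show ?thesis using assms(2) flow_mem by (simp add: exposed_face_def)
qed

section \<open>Cartan subalgebras in the presence of a definite invariant form\<close>

lemma lie_subalgebra_nilpotent_abelian:
  assumes H: "lie_subalgebra br H" "lie_nilpotent br H" and "x \<in> H" "y \<in> H"
  shows "br x y = 0"
proof -
  obtain n where n: "lower_central br H n = {0}" using H(2) unfolding lie_nilpotent_def by blast
  have "(br x ^^ k) y \<in> lower_central br H k" for k
  proof (induction k)
    case (Suc k)
    then show ?case using assms(3) by (auto simp: bracket_span_def intro!: span_base)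
  qed (use assms in simp)
  with n have "(br x ^^ n) y = 0" by blast
  \<comment> \<open>As \<open>br x\<close> is skew for a definite form, its square has the same
    kernel, so the powers can be peeled off one at a time.\<close>
  moreover have "(br x ^^ Suc k) y = 0 \<Longrightarrow> br x y = 0" for k
  proof (induction k)
    case (Suc k)
    let ?w = "(br x ^^ k) y"
    have "form (br x ?w) (br x ?w) = - form ?w (br x (br x ?w))" by (rule neg_killing_invariant)
    also have "\<dots> = 0" using Suc(2) by (simp add: form_simps)
    finally show ?case using Suc(1) by simp
  qed simp
  ultimately show ?thesis
    by (cases n) (simp_all add: br_simps)
qed

lemma cartan_facts:
  assumes H: "cartan_subalgebra br H"
  shows "subspace H" "\<And>x y. x \<in> H \<Longrightarrow> y \<in> H \<Longrightarrow> br x y = 0" "\<And>y. (\<And>h. h \<in> H \<Longrightarrow> br h y = 0) \<Longrightarrow> y \<in> H"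
proof -
  show ss: "subspace H" using H by (simp add: cartan_subalgebra_def lie_subalgebra_def)
  show "br x y = 0" if "x \<in> H" "y \<in> H" for x y
    using H that lie_subalgebra_nilpotent_abelian unfolding cartan_subalgebra_def by blast
  \<comment> \<open>An element commuting with H normalises H, and H is its own normaliser.\<close>
  show "y \<in> H" if "\<And>h. h \<in> H \<Longrightarrow> br h y = 0" for y
  proof -
    have "br y h = 0" if "h \<in> H" for h using \<open>\<And>h. h \<in> H \<Longrightarrow> br h y = 0\<close>[OF that] br_eq_0_commute by blast
    then have "y \<in> lie_normalizer br H" using subspace_0[OF ss] by (simp add: lie_normalizer_def)
    then show ?thesis using H by (simp add: cartan_subalgebra_def)
  qed
qed

text \<open>An element of \<open>H\<close> with a centralizer of least dimension is regular: moving it by \<open>\<epsilon> h'\<close>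
  shrinks the centralizer strictly unless \<open>h'\<close> already centralizes it.\<close>

lemma cartan_regular_element:
  assumes H: "cartan_subalgebra br H"
  shows "\<exists>h\<in>H. lie_centralizer br h = H"
proof -
  note cf = cartan_facts[OF H]
  let ?Z = "lie_centralizer br"
  have ssZ: "subspace (?Z h)" for h
    unfolding lie_centralizer_def by (rule linear_subspace_kernel[OF linear_br])
  define h where "h = arg_min (\<lambda>h. dim (?Z h)) (\<lambda>h. h \<in> H)"
  have h: "h \<in> H" "\<And>k. k \<in> H \<Longrightarrow> dim (?Z h) \<le> dim (?Z k)"
    using arg_min_nat_lemma[of "\<lambda>h. h \<in> H" 0 "\<lambda>h. dim (?Z h)"] subspace_0[OF cf(1)]
    unfolding h_def by auto
  have "br k y = 0" if y: "y \<in> ?Z h" and k: "k \<in> H" for k y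
  proof (rule ccontr)
    assume ky: "br k y \<noteq> 0"
    have comm: "br h (br k v) = br k (br h v)" for v
      using jacobi[of h k v] cf(2)[OF h(1) k] by (simp add: br_simps)
    \<comment> \<open>By skewness \<open>br h\<close> is injective on its range, and therefore
      bounded below there by some e.\<close>
    have "\<forall>w\<in>range (br h). br h w = 0 \<longrightarrow> w = 0"
    proof (clarify)
      fix v assume "br h (br h v) = 0"
      then have "form (br h v) (br h v) = 0" using neg_killing_invariant[of h v "br h v"] by (simp add: form_simps)
      then show "br h v = 0" by simp
    qed
    moreover have "subspace (range (br h))" by (rule linear_subspace_image[OF linear_br subspace_UNIV])
    ultimately obtain e where e: "e > 0" "\<And>w. w \<in> range (br h) \<Longrightarrow> norm (br h w) \<ge> e * norm w"
      using injective_imp_isometric[of "range (br h)" "br h"] closed_subspace linear_br linear_conv_bounded_linear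
      by metis
    obtain C where C: "C > 0" "\<And>v. norm (br k v) \<le> C * norm v"
      using linear_bounded_pos[OF linear_br] by blast
    \<comment> \<open>Chosen so that \<open>\<delta>\<close> times \<open>br k\<close> is weaker
      than the lower bound e of \<open>br h\<close> on its range; this forces
      \<open>br h v = 0\<close> for every v centralizing the moved element.\<close>
    define \<delta> where "\<delta> = e / (2 * C)"
    have \<delta>: "\<delta> > 0" "\<delta> * C < e" using e C by (auto simp: \<delta>_def)
    have "?Z (h + \<delta> *\<^sub>R k) \<subseteq> ?Z h"
    proof
      fix v assume "v \<in> ?Z (h + \<delta> *\<^sub>R k)"
      then have v: "br h v + \<delta> *\<^sub>R br k v = 0" by (simp add: lie_centralizer_def br_simps)
      let ?w = "br h v"
      have "br h ?w + \<delta> *\<^sub>R br k ?w = br h (br h v + \<delta> *\<^sub>R br k v)" by (simp add: br_simps comm)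
      also have "\<dots> = 0" using v by (simp add: br_simps)
      finally have "br h ?w = - (\<delta> *\<^sub>R br k ?w)" by (simp add: add_eq_0_iff2)
      then have "norm (br h ?w) = \<delta> * norm (br k ?w)" using \<delta>(1) by simp
      also have "\<dots> \<le> \<delta> * C * norm ?w" using C(2)[of ?w] \<delta>(1) by (simp add: mult.assoc)
      finally have "e * norm ?w \<le> \<delta> * C * norm ?w" using e(2)[of ?w] by simp
      then have "?w = 0" using \<delta>(2) by (simp add: mult_le_cancel_right)
      then show "v \<in> ?Z h" by (simp add: lie_centralizer_def)
    qed
    moreover have "y \<notin> ?Z (h + \<delta> *\<^sub>R k)"
      using y ky \<delta>(1) by (simp add: lie_centralizer_def br_simps)
    ultimately have "?Z (h + \<delta> *\<^sub>R k) \<subset> ?Z h" using y by blast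
    then have "dim (?Z (h + \<delta> *\<^sub>R k)) < dim (?Z h)"
      using dim_psubset[of "?Z (h + \<delta> *\<^sub>R k)" "?Z h"] by (simp add: span_eq_iff[THEN iffD2] ssZ)
    moreover have "h + \<delta> *\<^sub>R k \<in> H" using h(1) k cf(1) by (simp add: subspace_add subspace_scale)
    ultimately show False using h(2) by fastforce
  qed
  then have "?Z h \<subseteq> H" using cf(3) by blast
  moreover have "H \<subseteq> ?Z h" using cf(2) h(1) by (auto simp: lie_centralizer_def)
  ultimately show ?thesis using h(1) by blast
qed

text \<open>Let v maximise \<open>form v h\<close> on the face, where h has centralizer H. As
  \<open>br v h\<close> commutes with p, its flow preserves the face, and stationarity gives
  \<open>br v h\<close> length 0.\<close>

lemma exposed_face_meets_cartan:
  assumes H: "cartan_subalgebra br H" and p: "p \<in> H"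
  shows "exposed_face br B p \<inter> H \<noteq> {}"
proof -
  obtain h where h: "h \<in> H" "lie_centralizer br h = H" using cartan_regular_element[OF H] by blast
  have "continuous_on (exposed_face br B p) (\<lambda>v. form v h)"
    using linear_left linear_continuous_on linear_conv_bounded_linear by blast
  then obtain v where v: "v \<in> exposed_face br B p"
      "\<And>u. u \<in> exposed_face br B p \<Longrightarrow> form u h \<le> form v h"
    using continuous_attains_sup[OF compact_exposed_face exposed_face_nonempty] by blast
  let ?Y = "br v h"
  have vp: "br v p = 0" using exposed_face_commutes[OF v(1)] .
  have hp: "br h p = 0" using cartan_facts(2)[OF H h(1) p] .
  have "br p ?Y = 0"
    using jacobi[of p v h] vp hp br_eq_0_commute[of p v] br_eq_0_commute[of p h] by (simp add: br_simps)
  then have "form (br ?Y v) h = 0"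
    using v exposed_face_flow[of ?Y p v] br_eq_0_commute by (intro lin_exp_stationary linear_left) blast
  then have "?Y = 0" using form_br_left[of ?Y v h] by simp
  then have "v \<in> H" using h(2) br_eq_0_commute by (auto simp: lie_centralizer_def)
  with v(1) show ?thesis by blast
qed

section \<open>The polar polytope and its extreme points\<close>

lemma polar_in_le:
  assumes H: "cartan_subalgebra br H" and p: "p \<in> polar_in br H (B \<inter> H)" and b: "b \<in> B"
  shows "form b p \<le> 1"
proof -
  have "p \<in> H" using p by (simp add: polar_in_def)
  then obtain v where "v \<in> exposed_face br B p" "v \<in> H" using exposed_face_meets_cartan[OF H] by blast
  then have "form b p \<le> form v p" "form p v \<le> 1"
    using b p by (auto simp: exposed_face_def polar_in_def)
  then show ?thesis using sym[of p v] by simp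
qed

text \<open>The normaliser of the zero subspace is the whole space, which has positive
  dimension.\<close>

lemma cartan_neq_0:
  assumes "cartan_subalgebra br H"
  obtains d where "d \<in> H" "d \<noteq> 0"
proof -
  have "H \<noteq> {0}"
  proof
    assume "H = {0}"
    then have "lie_normalizer br H = UNIV" by (auto simp: lie_normalizer_def br_simps)
    then have "H = UNIV" using assms by (simp add: cartan_subalgebra_def)
    moreover obtain b :: 'e where "b \<in> Basis" using nonempty_Basis by blast
    ultimately show False using \<open>H = {0}\<close> nonzero_Basis by blast
  qed
  moreover have "0 \<in> H" using cartan_facts(1)[OF assms] subspace_0 by blast
  ultimately show ?thesis using that by blast
qed

text \<open>If the active vertices did not span H, some nonzero d in H would be orthogonal to all of
  them, and p could move along both d and -d inside the polar.\<close>

lemma polar_extreme_point_span: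
  assumes H: "cartan_subalgebra br H" and V: "finite V" "B \<inter> H = convex hull V"
    and p: "p extreme_point_of polar_in br H (B \<inter> H)"
  shows "span {v \<in> V. form v p = 1} = H"
proof (rule ccontr)
  let ?V1 = "{v \<in> V. form v p = 1}" let ?P = "polar_in br H (B \<inter> H)"
  assume ne: "span ?V1 \<noteq> H"
  have sH: "subspace H" using cartan_facts(1)[OF H] .
  have VH: "V \<subseteq> B \<inter> H" unfolding V(2) by (rule hull_subset)
  have pP: "p \<in> ?P" using p by (simp add: extreme_point_of_def)
  have "span ?V1 \<subseteq> H" using VH sH by (intro span_minimal) auto
  then obtain d where d: "d \<in> H" "d \<noteq> 0" "\<And>s. s \<in> span ?V1 \<Longrightarrow> form d s = 0"
    using orthogonal_vector_exists[OF subspace_span sH _ ne] by blast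
  have le: "form v p \<le> 1" if "v \<in> V" for v
    using polar_in_le[OF H pP] VH that by blast
  \<comment> \<open>Finitely many inactive vertices have positive slack; induction yields a common
    step length e.\<close>
  have "\<exists>e>0. \<forall>v\<in>W. \<bar>e * form v d\<bar> \<le> 1 - form v p" if "finite W" "W \<subseteq> V - ?V1" for W
    using that
  proof (induction W)
    case empty show ?case by (intro exI[of _ 1]) auto
  next
    case (insert w W)
    then obtain e where e: "e > 0" "\<And>v. v \<in> W \<Longrightarrow> \<bar>e * form v d\<bar> \<le> 1 - form v p" by auto
    have w: "form w p < 1" using insert.prems le[of w] by auto
    \<comment> \<open>The summand 1 avoids division by zero when
      \<open>form w d = 0\<close>.\<close>
    define e' where "e' = min e ((1 - form w p) / (1 + \<bar>form w d\<bar>))"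
    have "1 + \<bar>form w d\<bar> > 0" by simp
    then have e': "e' > 0" "e' \<le> e" "e' * (1 + \<bar>form w d\<bar>) \<le> 1 - form w p"
      using e(1) w by (simp_all add: e'_def flip: pos_le_divide_eq)
    have "\<bar>e' * form w d\<bar> \<le> 1 - form w p"
      using e'(1,3) by (simp add: abs_mult algebra_simps)
    moreover have "\<bar>e' * form v d\<bar> \<le> 1 - form v p" if "v \<in> W" for v
    proof -
      have "\<bar>e' * form v d\<bar> \<le> \<bar>e * form v d\<bar>" using e'(1,2) by (simp add: abs_mult mult_right_mono)
      then show ?thesis using e(2)[OF that] by simp
    qed
    ultimately show ?case using e'(1) by (intro exI[of _ e']) auto
  qed
  from this[of "V - ?V1"] V(1)
  obtain e where e: "e > 0" "\<And>v. v \<in> V - ?V1 \<Longrightarrow> \<bar>e * form v d\<bar> \<le> 1 - form v p" by auto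
  have leV: "\<bar>e * form v d\<bar> \<le> 1 - form v p" if "v \<in> V" for v
  proof (cases "v \<in> ?V1")
    case True
    then have "form v d = 0" using d(3)[OF span_base] sym[of v d] by simp
    then show ?thesis using True by simp
  qed (use e that in blast)
  have mem: "p + s *\<^sub>R d \<in> ?P" if s: "\<bar>s\<bar> = e" for s
  proof -
    have "form (p + s *\<^sub>R d) v \<le> 1" if "v \<in> V" for v
    proof -
      have "form (p + s *\<^sub>R d) v = form v p + s * form v d"
        using sym[of p v] sym[of d v] by (simp add: form_simps)
      moreover have "\<bar>s * form v d\<bar> \<le> 1 - form v p" using leV[OF that] s e(1) by (simp add: abs_mult)
      ultimately show ?thesis by linarith
    qed
    \<comment> \<open>The constraints of the polar need checking only at the points of V, whose
      convex hull is \<open>B \<inter> H\<close>.\<close>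
    then have "V \<subseteq> {v. form (p + s *\<^sub>R d) v \<le> 1}" by blast
    moreover have "convex {v. form (p + s *\<^sub>R d) v \<le> 1}"
      using convex_linear_vimage[OF linear_right convex_real_interval(2)[of 1], of "p + s *\<^sub>R d"]
      by (simp add: vimage_def)
    ultimately have "B \<inter> H \<subseteq> {v. form (p + s *\<^sub>R d) v \<le> 1}" unfolding V(2) by (rule hull_minimal)
    moreover have "p + s *\<^sub>R d \<in> H"
      using pP d(1) sH by (auto simp: polar_in_def intro!: subspace_add subspace_scale)
    ultimately show ?thesis by (auto simp: polar_in_def)
  qed
  have "p + e *\<^sub>R d \<in> ?P" "p + (- e) *\<^sub>R d \<in> ?P" using mem[of e] mem[of "- e"] e(1) by simp_all
  moreover have "p \<in> open_segment (p + (- e) *\<^sub>R d) (p + e *\<^sub>R d)"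
    unfolding in_segment
  proof (intro conjI exI[of _ "1/2"])
    show "p + - e *\<^sub>R d \<noteq> p + e *\<^sub>R d"
    proof
      assume "p + - e *\<^sub>R d = p + e *\<^sub>R d"
      then have "(2 * e) *\<^sub>R d = 0" by (simp add: neg_eq_iff_add_eq_0 scaleR_add_left[symmetric])
      then show False using e(1) d(2) by simp
    qed
    show "p = (1 - 1/2) *\<^sub>R (p + - e *\<^sub>R d) + (1/2) *\<^sub>R (p + e *\<^sub>R d)"
      by (simp add: scaleR_add_right scaleR_diff_right scaleR_add_left[symmetric])
  qed simp_all
  ultimately show False using p by (auto simp: extreme_point_of_def)
qed

text \<open>In such a triple v and w lie in the face of x, where c is the maximum over B. All
  conditions are closed, and \<open>coercive\<close> bounds x.\<close>

lemma compact_face_triples: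
  "compact {(x, v, w). v \<in> B \<and> w \<in> B \<and> form x x = a \<and> (\<forall>b\<in>B. form b x \<le> c) \<and>
     form v x = c \<and> form w x = c \<and> form (br v w) (br v w) = r}" (is "compact ?S")
proof (unfold compact_eq_bounded_closed, rule conjI)
  obtain m where m: "m > 0" "\<And>u. m * (norm u)\<^sup>2 \<le> form u u" using coercive by blast
  have "{x. form x x = a} \<subseteq> cball 0 (sqrt (a / m))"
  proof clarify
    fix x assume "a = form x x"
    then have "(norm x)\<^sup>2 \<le> a / m" using m(2)[of x] m(1) by (simp add: field_simps)
    then show "x \<in> cball 0 (sqrt (form x x / m))"
      using real_le_rsqrt by (simp add: \<open>a = form x x\<close>)
  qed
  then have "bounded {x. form x x = a}" using bounded_subset bounded_cball by blast
  then have "bounded ({x. form x x = a} \<times> B \<times> B)"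
    using compact_imp_bounded[OF body_facts(1)] by (intro bounded_Times)
  then show "bounded ?S" by (rule bounded_subset) auto
  have bb: "bounded_bilinear form" "bounded_bilinear br"
    using bilinear bilinear_br by (simp_all add: bilinear_conv_bounded_bilinear)
  note cont = bounded_bilinear.continuous_on[OF bb(1)] bounded_bilinear.continuous_on[OF bb(2)]
    continuous_on_fst continuous_on_snd continuous_on_id continuous_on_const
  let ?x = "fst :: 'e \<times> 'e \<times> 'e \<Rightarrow> 'e" and ?v = "\<lambda>z::'e \<times> 'e \<times> 'e. fst (snd z)" and ?w = "\<lambda>z::'e \<times> 'e \<times> 'e. snd (snd z)"
  have S: "?S = ?v -` B \<inter> ?w -` B \<inter> {z. form (?x z) (?x z) = a} \<inter> (\<Inter>b\<in>B. {z. form b (?x z) \<le> c}) \<inter>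
      {z. form (?v z) (?x z) = c} \<inter> {z. form (?w z) (?x z) = c} \<inter> {z. form (br (?v z) (?w z)) (br (?v z) (?w z)) = r}"
    by auto
  show "closed ?S"
    unfolding S
    by (intro closed_Int closed_INT ballI closed_Collect_le closed_Collect_eq cont
        continuous_closed_vimage body_facts(3) continuous_intros)
qed

text \<open>Every face is carried into a face \<open>F\<^sub>x\<close> with \<open>x \<in> H\<close> by maximising \<open>\<langle>x, h\<rangle>\<close>, for a regular
  \<open>h\<close>, over a compact flow-invariant set of triples \<open>(x, v, w)\<close> with \<open>v, w \<in> F\<^sub>x\<close>; on it the length of
  \<open>[v, w]\<close> is constant.\<close>

lemma exposed_face_commuting_reduction:
  assumes H: "cartan_subalgebra br H"
    and comm: "\<And>x. x \<in> H \<Longrightarrow> x \<noteq> 0 \<Longrightarrow> lie_commuting br (exposed_face br B x)"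
    and x: "x \<noteq> 0"
  shows "lie_commuting br (exposed_face br B x)"
  unfolding lie_commuting_def
proof (intro ballI)
  fix v w assume vw: "v \<in> exposed_face br B x" "w \<in> exposed_face br B x"
  obtain h where h: "h \<in> H" "lie_centralizer br h = H" using cartan_regular_element[OF H] by blast
  define S where "S = {(x', v', w'). v' \<in> B \<and> w' \<in> B \<and> form x' x' = form x x \<and>
     (\<forall>b\<in>B. form b x' \<le> form v x) \<and> form v' x' = form v x \<and> form w' x' = form v x \<and>
     form (br v' w') (br v' w') = form (br v w) (br v w)}"
  have "compact S" unfolding S_def by (rule compact_face_triples)
  moreover have "(x, v, w) \<in> S" using vw by (auto simp: S_def exposed_face_def intro: antisym)
  moreover have "continuous_on S (\<lambda>z. form (fst z) h)"
    using bilinear by (intro bounded_bilinear.continuous_on[of form] continuous_intros)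
      (simp_all add: bilinear_conv_bounded_bilinear)
  ultimately obtain z where z: "z \<in> S" "\<And>z'. z' \<in> S \<Longrightarrow> form (fst z') h \<le> form (fst z) h"
    using continuous_attains_sup[of S "\<lambda>z. form (fst z) h"] by blast
  obtain x' v' w' where z': "z = (x', v', w')" by (cases z)
  have S: "v' \<in> B" "w' \<in> B" "form x' x' = form x x" "\<And>b. b \<in> B \<Longrightarrow> form b x' \<le> form v x" "form v' x' = form v x"
    "form w' x' = form v x" "form (br v' w') (br v' w') = form (br v w) (br v w)"
    using z(1) by (auto simp: S_def z')
  have "form (lin_exp (br Y) t x') h \<le> form x' h" for Y t
  proof -
    let ?F = "lin_exp (br Y) t"
    \<comment> \<open>The flow is isometric, so it can be moved back onto b, which stays in
      B.\<close>
    have "form b (?F x') \<le> form v x" if "b \<in> B" for b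
    proof -
      have "form b (?F x') = form (?F (lin_exp (br Y) (- t) b)) (?F x')" by (simp add: lin_exp_minus[OF linear_br])
      also have "\<dots> \<le> form v x" unfolding lin_exp_neg_killing by (intro S(4) flow_mem that)
      finally show ?thesis .
    qed
    then have "(?F x', ?F v', ?F w') \<in> S"
      using S by (simp add: S_def flow_mem lin_exp_neg_killing lin_exp_br[symmetric])
    from z(2)[OF this] show ?thesis by (simp add: z')
  qed
  then have "form (br Y x') h = 0" for Y by (intro lin_exp_stationary linear_left)
  \<comment> \<open>Again the choice of Y gives a squared length; thus x' centralizes h and lies in
    H.\<close>
  from this[of "br x' h"] have "br x' h = 0" using form_br_left[of "br x' h" x' h] by simp
  then have "x' \<in> H" using h(2) br_eq_0_commute[of x' h] by (auto simp: lie_centralizer_def)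
  moreover have "x' \<noteq> 0" using S(3) x eq_0_iff by metis
  moreover have "v' \<in> exposed_face br B x'" "w' \<in> exposed_face br B x'"
    using S by (auto simp: exposed_face_def)
  ultimately have "br v' w' = 0" using comm unfolding lie_commuting_def by blast
  then show "br v w = 0" using S(7) by (simp add: form_simps)
qed

section \<open>Convexity and compactness of the polar\<close>

lemma form_normalize:
  assumes "x \<noteq> 0" "r > 0"
  shows "form (sqrt (r / form x x) *\<^sub>R x) (sqrt (r / form x x) *\<^sub>R x) = r"
proof -
  have "form (sqrt (r / form x x) *\<^sub>R x) (sqrt (r / form x x) *\<^sub>R x) = (sqrt (r / form x x))\<^sup>2 * form x x"
    by (simp only: form_simps power2_eq_square mult.assoc real_scaleR_def)
  also have "(sqrt (r / form x x))\<^sup>2 = r / form x x" using assms(2) nonneg[of x] by (intro real_sqrt_pow2) simp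
  finally show ?thesis using assms(1) by simp
qed

lemma polar_in_convex: "subspace H \<Longrightarrow> convex (polar_in br H E)"
proof -
  assume H: "subspace H"
  have "polar_in br H E = H \<inter> (\<Inter>y\<in>E. (\<lambda>x. form x y) -` {..1})" by (auto simp: polar_in_def)
  then show ?thesis
    using H by (simp only:) (intro convex_Int convex_INT subspace_imp_convex convex_linear_vimage linear_left convex_real_interval)
qed

text \<open>By \<open>zero_interior\<close> the positive multiple of p with squared length r lies in
  \<open>B \<inter> H\<close>; testing p against it bounds \<open>form p p\<close> by 1 / r.\<close>

lemma polar_in_compact:
  assumes H: "subspace H"
  shows "compact (polar_in br H (B \<inter> H))"
proof (unfold compact_eq_bounded_closed, rule conjI)
  have "polar_in br H (B \<inter> H) = H \<inter> (\<Inter>y\<in>B \<inter> H. (\<lambda>x. form x y) -` {..1})" by (auto simp: polar_in_def)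
  moreover have "closed ((\<lambda>x. form x y) -` {..1})" for y
    using linear_left[of y] by (intro continuous_closed_vimage closed_atMost linear_continuous_at)
      (simp add: linear_conv_bounded_linear)
  ultimately show "closed (polar_in br H (B \<inter> H))"
    using closed_subspace[OF H] by (simp only:) (intro closed_Int closed_INT ballI)
  obtain r where r: "r > 0" "\<And>u. form u u \<le> r \<Longrightarrow> u \<in> B" using zero_interior by blast
  obtain m where m: "m > 0" "\<And>u. m * (norm u)\<^sup>2 \<le> form u u" using coercive by blast
  have "norm p \<le> sqrt (1 / r / m)" if p: "p \<in> polar_in br H (B \<inter> H)" for p
  proof (cases "p = 0")
    case False
    let ?s = "sqrt (r / form p p)"
    have q: "form p p > 0" using pos False .
    have "form (?s *\<^sub>R p) (?s *\<^sub>R p) = r" using form_normalize[OF False r(1)] .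
    then have "?s *\<^sub>R p \<in> B \<inter> H" using r(2) p H by (auto simp: polar_in_def subspace_scale)
    then have "form p (?s *\<^sub>R p) \<le> 1" using p by (auto simp: polar_in_def)
    then have "(?s * form p p)\<^sup>2 \<le> 1\<^sup>2" using q r(1) by (intro power_mono) (auto simp: form_simps)
    moreover have "(?s * form p p)\<^sup>2 = r * form p p"
      using q r(1) False unfolding power_mult_distrib by (subst real_sqrt_pow2) (auto simp: power2_eq_square)
    ultimately have "r * form p p \<le> 1" by simp
    then have "form p p \<le> 1 / r" using r(1) by (simp add: field_simps)
    then have "m * (norm p)\<^sup>2 \<le> 1 / r" using m(2)[of p] by simp
    then have "(norm p)\<^sup>2 \<le> 1 / r / m" using m(1) by (subst pos_le_divide_eq) (simp_all add: mult.commute)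
    then show ?thesis by (rule real_le_rsqrt)
  qed (use m(1) r(1) in simp)
  then show "bounded (polar_in br H (B \<inter> H))" by (auto simp: bounded_iff)
qed

section \<open>Abelian faces versus regular extreme points: the two implications\<close>

lemma commuting_faces_imp_regular:
  assumes H: "cartan_subalgebra br H" and poly: "polytope (B \<inter> H)"
    and comm: "\<And>x. x \<noteq> 0 \<Longrightarrow> lie_commuting br (exposed_face br B x)"
    and p: "p extreme_point_of polar_in br H (B \<inter> H)"
  shows "lie_regular br p"
proof -
  obtain V where V: "finite V" "B \<inter> H = convex hull V" using poly unfolding polytope_def by blast
  let ?V = "{v \<in> V. form v p = 1}" let ?F = "exposed_face br B p"
  have sp: "span ?V = H" using polar_extreme_point_span[OF H V p] .
  note cf = cartan_facts[OF H]
  have pP: "p \<in> polar_in br H (B \<inter> H)" using p by (simp add: extreme_point_of_def)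
  then have pH: "p \<in> H" by (simp add: polar_in_def)
  \<comment> \<open>At p = 0 no vertex is active, whereas the active vertices span H, which is
    nonzero.\<close>
  have p0: "p \<noteq> 0"
  proof
    assume "p = 0"
    then have "?V = {}" by (simp add: form_simps)
    then have "H = {0}" using sp span_empty by metis
    then show False using cartan_neq_0[OF H] by blast
  qed
  \<comment> \<open>As p is bounded by 1 on all of B, the value 1 at an active vertex is the
    maximum.\<close>
  have VF: "?V \<subseteq> ?F"
    using V hull_subset[of V convex] polar_in_le[OF H pP] by (auto simp: exposed_face_def)
  have "y \<in> H" if y: "br p y = 0" for y
  proof (rule cf(3))
    fix h assume hH: "h \<in> H"
    have "br s (br y s') = 0" if s: "s \<in> ?V" "s' \<in> ?V" for s s'
    proof -
      have "br s (lin_exp (br y) t s') = 0" for t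
      proof -
        have "lin_exp (br y) t s' \<in> ?F" using exposed_face_flow y br_eq_0_commute[of p y] VF s(2) by blast
        then show ?thesis using comm[OF p0] VF s(1) unfolding lie_commuting_def by blast
      qed
      then have "form u (br s (lin_exp (br y) t s')) = 0" for u t by (simp add: form_simps)
      moreover from this[of _ 0] have "form u (br s s') = 0" for u by (simp add: lin_exp_0[OF linear_br])
      \<comment> \<open>The function \<open>form u (br s v)\<close> vanishes along the whole flow of
        s', so time 0 is trivially a maximum and the derivative there is 0.\<close>
      ultimately have "form u (br s (br y s')) = 0" for u
        using linear_compose[OF linear_br[of s] linear_right[of u]] 
        by (intro lin_exp_stationary[of "\<lambda>v. form u (br s v)"]) (simp_all add: o_def)
      from this[of "br s (br y s')"] show ?thesis by simp
    qed
    \<comment> \<open>Linearity passes from \<open>?V\<close> to its span H, first in the inner slot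
      and afterwards in the outer one.\<close>
    then have 1: "br s (br y h) = 0" if "s \<in> ?V" for s
      using linear_eq_0_on_span[OF linear_compose[OF linear_br[of y] linear_br[of s]], of ?V h] that hH sp
      unfolding o_def by blast
    have "h \<in> span ?V" using hH sp by simp
    from linear_eq_0_on_span[OF linear_br_left 1 this] have "br h (br y h) = 0" .
    moreover have "br h (br y h) = - br h (br h y)" unfolding skew_br[of y h] by (rule br_simps)
    ultimately have "form (br h (br h y)) y = 0" by (simp add: form_simps)
    then have "form (br h y) (br h y) = 0" unfolding neg_killing_invariant[of h "br h y" y] by simp
    then show "br h y = 0" by simp
  qed
  then have "lie_centralizer br p \<subseteq> H" unfolding lie_centralizer_def by blast
  moreover have "H \<subseteq> lie_centralizer br p" using cf(2)[OF pH] unfolding lie_centralizer_def by blast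
  ultimately have "lie_centralizer br p = H" by (rule equalityI)
  then show ?thesis using H by (simp add: lie_regular_def)
qed

lemma regular_imp_commuting_faces:
  assumes H: "cartan_subalgebra br H"
    and reg: "\<And>p. p extreme_point_of polar_in br H (B \<inter> H) \<Longrightarrow> lie_regular br p"
    and x: "x \<noteq> 0"
  shows "lie_commuting br (exposed_face br B x)"
proof (rule exposed_face_commuting_reduction[OF H _ x])
  fix x assume xH: "x \<in> H" and x: "x \<noteq> 0"
  note cf = cartan_facts[OF H]
  let ?P = "polar_in br H (B \<inter> H)" let ?F = "exposed_face br B x"
  obtain w where w: "w \<in> ?F" using exposed_face_nonempty by blast
  let ?c = "form w x"
  obtain r where r: "r > 0" "\<And>u. form u u \<le> r \<Longrightarrow> u \<in> B" using zero_interior by blast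
  \<comment> \<open>Since 0 is interior, B contains a positive multiple of x.\<close>
  have c: "?c > 0"
  proof -
    have q: "form x x > 0" using pos x .
    let ?s = "sqrt (r / form x x)"
    have "form (?s *\<^sub>R x) (?s *\<^sub>R x) = r" using form_normalize[OF x r(1)] .
    then have "form (?s *\<^sub>R x) x \<le> ?c" using r(2) w by (auto simp: exposed_face_def)
    moreover have "form (?s *\<^sub>R x) x > 0" using q r(1) by (simp add: form_simps)
    ultimately show ?thesis by linarith
  qed
  \<comment> \<open>The multiple of x whose maximum over B is 1.\<close>
  define x' where "x' = (1 / ?c) *\<^sub>R x"
  have x': "form u x' \<le> 1" if "u \<in> B" for u
    using w c that by (auto simp: x'_def form_simps exposed_face_def)
  have F1: "form v x' = 1" if "v \<in> ?F" for v
  proof -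
    have "form v x = ?c" using w that by (auto simp: exposed_face_def intro: antisym)
    then show ?thesis using c by (simp add: x'_def form_simps)
  qed
  \<comment> \<open>The face of the polar dual to \<open>?F\<close>. An extreme point p of it is
    extreme in \<open>?P\<close>, and its maximum 1 over B is attained on all of
    \<open>?F\<close>.\<close>
  let ?G = "{y \<in> ?P. \<forall>v\<in>?F. form v y = 1}"
  have leP: "form v y \<le> 1" if "v \<in> B" "y \<in> ?P" for v y using polar_in_le[OF H that(2,1)] .
  have FB: "?F \<subseteq> B" by (auto simp: exposed_face_def)
  have "x' \<in> ?P" using x' xH cf(1) sym[of x'] by (auto simp: polar_in_def x'_def subspace_scale)
  then have "x' \<in> ?G" using F1 by blast
  have "?G face_of ?P"
    unfolding face_of_def
  proof (intro conjI ballI impI)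
    have "convex {y. form v y = 1}" for v
      using convex_linear_vimage[OF linear_right convex_singleton[of 1], of v] by (simp add: vimage_def)
    then have "convex (?P \<inter> (\<Inter>v\<in>?F. {y. form v y = 1}))"
      using polar_in_convex[OF cf(1)] by (intro convex_Int convex_INT) auto
    moreover have "?P \<inter> (\<Inter>v\<in>?F. {y. form v y = 1}) = ?G" by auto
    ultimately show "convex ?G" by simp
  next
    fix a b y assume ab: "a \<in> ?P" "b \<in> ?P" and y: "y \<in> ?G" and "y \<in> open_segment a b"
    then obtain u where u: "0 < u" "u < 1" "y = (1 - u) *\<^sub>R a + u *\<^sub>R b" by (auto simp: in_segment)
    have *: "form v a = 1 \<and> form v b = 1" if v: "v \<in> ?F" for v
    proof -
      have le: "form v a \<le> 1" "form v b \<le> 1" using leP FB v ab by blast+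
      have "(1 - u) * form v a + u * form v b = 1" using y v by (simp add: u form_simps)
      then have "(1 - u) * (1 - form v a) + u * (1 - form v b) = 0" by (simp add: algebra_simps)
      moreover have "(1 - u) * (1 - form v a) \<ge> 0" "u * (1 - form v b) \<ge> 0" using le u by simp_all
      ultimately have "(1 - u) * (1 - form v a) = 0" "u * (1 - form v b) = 0" by linarith+
      then show ?thesis using u by simp
    qed
    then show "a \<in> ?G" "b \<in> ?G" using ab by blast+
  qed auto
  then have "compact ?G" "convex ?G"
    using face_of_imp_compact polar_in_convex polar_in_compact cf(1) face_of_imp_convex by blast+
  then obtain p where "p extreme_point_of ?G"
    using extreme_point_exists_convex[of ?G] \<open>x' \<in> ?G\<close> by blast
  then have p: "p extreme_point_of ?P" "p \<in> ?G" using extreme_point_of_face[OF \<open>?G face_of ?P\<close>] by blast+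
  have car: "cartan_subalgebra br (lie_centralizer br p)" using reg[OF p(1)] by (simp add: lie_regular_def)
  have "v \<in> lie_centralizer br p" if "v \<in> ?F" for v
  proof -
    have "v \<in> exposed_face br B p" using p that leP FB by (auto simp: exposed_face_def)
    then show ?thesis using exposed_face_commutes br_eq_0_commute[of v p] by (simp add: lie_centralizer_def)
  qed
  then show "lie_commuting br ?F" using cartan_facts(2)[OF car] by (auto simp: lie_commuting_def)
qed

end

section \<open>The Lie algebra of a Lie group in a chart\<close>

text \<open>The second difference of \<open>f\<close> over the parallelogram spanned by \<open>t v\<close> and \<open>t w\<close> is symmetric in
  \<open>v\<close> and \<open>w\<close>, and by the mean value theorem it is \<open>t\<^sup>2 Dv w\<close> up to \<open>o(t\<^sup>2)\<close>.\<close>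

lemma second_difference:
  fixes f :: "'a::real_normed_vector \<Rightarrow> real"
  assumes S: "open S" "p \<in> S" and D: "\<And>x. x \<in> S \<Longrightarrow> (f has_derivative D x) (at x)"
    and Dv: "((\<lambda>x. D x v) has_derivative Dv) (at p)" and \<epsilon>: "\<epsilon> > 0"
  shows "\<exists>\<delta>>0. \<forall>t. 0 < t \<and> t < \<delta> \<longrightarrow>
    \<bar>f (p + t *\<^sub>R v + t *\<^sub>R w) - f (p + t *\<^sub>R v) - f (p + t *\<^sub>R w) + f p - t\<^sup>2 * Dv w\<bar> \<le> \<epsilon> * t\<^sup>2"
proof -
  \<comment> \<open>All points \<open>p + s v + r w\<close> with s and r in [0, t] are within
    \<open>t * L\<close> of p; the summand 1 keeps L positive.\<close>
  define L where "L = norm v + norm w + 1"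
  have L: "L > 0" by (simp add: L_def add_nonneg_pos)
  obtain d1 where d1: "d1 > 0" "ball p d1 \<subseteq> S" using S open_contains_ball by blast
  have "\<epsilon> / (2 * L) > 0" using \<epsilon> L by simp
  then obtain d2 where d2: "d2 > 0"
    "\<And>y. norm (y - p) < d2 \<Longrightarrow> \<bar>D y v - D p v - Dv (y - p)\<bar> \<le> \<epsilon> / (2 * L) * norm (y - p)"
    using Dv unfolding has_derivative_at_alt by (metis real_norm_def)
  interpret Dv: bounded_linear Dv using Dv by (rule has_derivative_bounded_linear)
  define \<delta> where "\<delta> = min d1 d2 / L"
  have "\<delta> > 0" using d1 d2 L by (simp add: \<delta>_def)
  moreover have "\<bar>f (p + t *\<^sub>R v + t *\<^sub>R w) - f (p + t *\<^sub>R v) - f (p + t *\<^sub>R w) + f p - t\<^sup>2 * Dv w\<bar> \<le> \<epsilon> * t\<^sup>2"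
    if t: "0 < t" "t < \<delta>" for t
  proof -
    have small: "norm (s *\<^sub>R v + r *\<^sub>R w) < min d1 d2" "norm (s *\<^sub>R v + r *\<^sub>R w) \<le> t * L"
      if "0 \<le> s" "s \<le> t" "0 \<le> r" "r \<le> t" for s r
    proof -
      have "norm (s *\<^sub>R v + r *\<^sub>R w) \<le> s * norm v + r * norm w"
        using norm_triangle_ineq[of "s *\<^sub>R v" "r *\<^sub>R w"] that by simp
      also have "\<dots> \<le> t * norm v + t * norm w" using that by (intro add_mono mult_right_mono) auto
      also have "\<dots> \<le> t * L" using t by (simp add: L_def algebra_simps)
      finally show *: "norm (s *\<^sub>R v + r *\<^sub>R w) \<le> t * L" .
      also have "t * L < min d1 d2" using t(2) L by (simp add: \<delta>_def pos_less_divide_eq)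
      finally show "norm (s *\<^sub>R v + r *\<^sub>R w) < min d1 d2" .
    qed
    \<comment> \<open>The second difference equals \<open>g t - g 0\<close>, ready for the mean
      value theorem.\<close>
    define g where "g s = f (p + s *\<^sub>R v + t *\<^sub>R w) - f (p + s *\<^sub>R v)" for s
    have g': "(g has_real_derivative D (p + s *\<^sub>R v + t *\<^sub>R w) v - D (p + s *\<^sub>R v) v) (at s)"
      if s: "0 \<le> s" "s \<le> t" for s
    proof -
      have f': "((\<lambda>s. f (p + s *\<^sub>R v + r *\<^sub>R w)) has_real_derivative D (p + s *\<^sub>R v + r *\<^sub>R w) v) (at s)"
        if r: "0 \<le> r" "r \<le> t" for r
      proof -
        have "p + s *\<^sub>R v + r *\<^sub>R w - p = s *\<^sub>R v + r *\<^sub>R w" by simp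
        then have "p + s *\<^sub>R v + r *\<^sub>R w \<in> ball p d1"
          using small(1)[OF s r] by (simp only: mem_ball dist_norm norm_minus_commute[of p] min_less_iff_conj)
        then have "p + s *\<^sub>R v + r *\<^sub>R w \<in> S" using d1(2) by blast
        from D[OF this] have fD: "(f has_derivative D (p + s *\<^sub>R v + r *\<^sub>R w)) (at (p + s *\<^sub>R v + r *\<^sub>R w))" .
        have "((\<lambda>s. p + s *\<^sub>R v + r *\<^sub>R w) has_derivative (\<lambda>h. h *\<^sub>R v)) (at s)"
          by (auto intro!: derivative_eq_intros)
        from has_derivative_compose[OF this fD]
        show ?thesis
          using linear_scale[OF has_derivative_linear[OF fD]]
          by (simp add: has_field_derivative_def mult_commute_abs)
      qed
      show ?thesis unfolding g_def using f'[of t] f'[of 0] t(1) by (intro DERIV_diff) simp_all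
    qed
    obtain \<xi> where \<xi>: "0 < \<xi>" "\<xi> < t" "g t - g 0 = (t - 0) * (D (p + \<xi> *\<^sub>R v + t *\<^sub>R w) v - D (p + \<xi> *\<^sub>R v) v)"
      using MVT2[OF t(1) g'] by blast
    \<comment> \<open>Used for r = t and for r = 0, each contributing half of the error.\<close>
    have est: "\<bar>D (p + (\<xi> *\<^sub>R v + r *\<^sub>R w)) v - D p v - Dv (\<xi> *\<^sub>R v + r *\<^sub>R w)\<bar> \<le> \<epsilon> / 2 * t" if r: "0 \<le> r" "r \<le> t" for r
    proof -
      have \<xi>': "0 \<le> \<xi>" "\<xi> \<le> t" using \<xi> by auto
      have "\<bar>D (p + (\<xi> *\<^sub>R v + r *\<^sub>R w)) v - D p v - Dv (\<xi> *\<^sub>R v + r *\<^sub>R w)\<bar> \<le> \<epsilon> / (2 * L) * norm (\<xi> *\<^sub>R v + r *\<^sub>R w)"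
        using d2(2)[of "p + (\<xi> *\<^sub>R v + r *\<^sub>R w)"] small(1)[OF \<xi>' r] by simp
      also have "\<dots> \<le> \<epsilon> / (2 * L) * (t * L)" using small(2)[OF \<xi>' r] \<epsilon> L by (intro mult_left_mono) auto
      also have "\<dots> = \<epsilon> / 2 * t" using L by simp
      finally show ?thesis .
    qed
    have "\<bar>(D (p + \<xi> *\<^sub>R v + t *\<^sub>R w) v - D (p + \<xi> *\<^sub>R v) v) - t * Dv w\<bar> \<le> \<epsilon> * t"
    proof -
      let ?a = "D (p + (\<xi> *\<^sub>R v + t *\<^sub>R w)) v - D p v - Dv (\<xi> *\<^sub>R v + t *\<^sub>R w)"
      let ?b = "D (p + (\<xi> *\<^sub>R v + 0 *\<^sub>R w)) v - D p v - Dv (\<xi> *\<^sub>R v + 0 *\<^sub>R w)"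
      have "(D (p + \<xi> *\<^sub>R v + t *\<^sub>R w) v - D (p + \<xi> *\<^sub>R v) v) - t * Dv w = ?a - ?b"
        by (simp add: Dv.add Dv.scaleR add.assoc)
      moreover have "\<bar>?a - ?b\<bar> \<le> \<epsilon> / 2 * t + \<epsilon> / 2 * t"
        by (rule order_trans[OF abs_triangle_ineq4 add_mono[OF est est]]) (use t(1) in simp_all)
      ultimately show ?thesis by simp
    qed
    then have "t * \<bar>(D (p + \<xi> *\<^sub>R v + t *\<^sub>R w) v - D (p + \<xi> *\<^sub>R v) v) - t * Dv w\<bar> \<le> t * (\<epsilon> * t)"
      using t(1) by (intro mult_left_mono) auto
    note bound = this
    have "\<bar>g t - g 0 - t\<^sup>2 * Dv w\<bar> \<le> \<epsilon> * t\<^sup>2"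
    proof -
      have "g t - g 0 - t\<^sup>2 * Dv w = t * ((D (p + \<xi> *\<^sub>R v + t *\<^sub>R w) v - D (p + \<xi> *\<^sub>R v) v) - t * Dv w)"
        unfolding \<xi>(3) by (simp add: right_diff_distrib power2_eq_square)
      then have "\<bar>g t - g 0 - t\<^sup>2 * Dv w\<bar> = t * \<bar>(D (p + \<xi> *\<^sub>R v + t *\<^sub>R w) v - D (p + \<xi> *\<^sub>R v) v) - t * Dv w\<bar>"
        using t(1) by (simp only: abs_mult abs_of_pos)
      also note bound
      also have "t * (\<epsilon> * t) = \<epsilon> * t\<^sup>2" by (simp add: power2_eq_square)
      finally show ?thesis .
    qed
    then show ?thesis by (simp add: g_def algebra_simps)
  qed
  ultimately show ?thesis by blast
qed

text \<open>Both mixed derivatives approximate the same second difference up to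
  \<open>\<epsilon> * t\<^sup>2\<close>. With \<epsilon> a quarter of their gap, four such errors
  would be at most two.\<close>

lemma second_derivative_symmetric_real:
  fixes f :: "'a::real_normed_vector \<Rightarrow> real"
  assumes S: "open S" "p \<in> S" and D: "\<And>x. x \<in> S \<Longrightarrow> (f has_derivative D x) (at x)"
    and Dv: "((\<lambda>x. D x v) has_derivative Dv) (at p)" and Dw: "((\<lambda>x. D x w) has_derivative Dw) (at p)"
  shows "Dv w = Dw v"
proof (rule ccontr)
  assume ne: "Dv w \<noteq> Dw v"
  define \<epsilon> where "\<epsilon> = \<bar>Dv w - Dw v\<bar> / 4"
  have \<epsilon>: "\<epsilon> > 0" using ne by (simp add: \<epsilon>_def)
  obtain \<delta>1 where 1: "\<delta>1 > 0" "\<And>t. 0 < t \<Longrightarrow> t < \<delta>1 \<Longrightarrow>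
    \<bar>f (p + t *\<^sub>R v + t *\<^sub>R w) - f (p + t *\<^sub>R v) - f (p + t *\<^sub>R w) + f p - t\<^sup>2 * Dv w\<bar> \<le> \<epsilon> * t\<^sup>2"
    using second_difference[OF S D Dv \<epsilon>, of w] by blast
  obtain \<delta>2 where 2: "\<delta>2 > 0" "\<And>t. 0 < t \<Longrightarrow> t < \<delta>2 \<Longrightarrow>
    \<bar>f (p + t *\<^sub>R w + t *\<^sub>R v) - f (p + t *\<^sub>R w) - f (p + t *\<^sub>R v) + f p - t\<^sup>2 * Dw v\<bar> \<le> \<epsilon> * t\<^sup>2"
    using second_difference[OF S D Dw \<epsilon>, of v] by blast
  obtain t where t: "0 < t" "t < \<delta>1" "t < \<delta>2" using 1(1) 2(1) field_lbound_gt_zero by blast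
  let ?d = "f (p + t *\<^sub>R v + t *\<^sub>R w) - f (p + t *\<^sub>R v) - f (p + t *\<^sub>R w) + f p"
  have "\<bar>?d - t\<^sup>2 * Dv w\<bar> \<le> \<epsilon> * t\<^sup>2" "\<bar>?d - t\<^sup>2 * Dw v\<bar> \<le> \<epsilon> * t\<^sup>2"
    using 1(2)[OF t(1,2)] 2(2)[OF t(1,3)] by (simp_all add: algebra_simps)
  then have "\<bar>t\<^sup>2 * Dv w - t\<^sup>2 * Dw v\<bar> \<le> 2 * \<epsilon> * t\<^sup>2" by linarith
  moreover have "\<bar>t\<^sup>2 * Dv w - t\<^sup>2 * Dw v\<bar> = 4 * \<epsilon> * t\<^sup>2"
    by (simp add: \<epsilon>_def abs_mult flip: right_diff_distrib)
  ultimately show False using \<epsilon> t(1) by simp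
qed

lemma second_derivative_symmetric:
  fixes f :: "'a::real_normed_vector \<Rightarrow> 'b::real_inner"
  assumes S: "open S" "p \<in> S" and D: "\<And>x. x \<in> S \<Longrightarrow> (f has_derivative D x) (at x)"
    and Dv: "((\<lambda>x. D x v) has_derivative Dv) (at p)" and Dw: "((\<lambda>x. D x w) has_derivative Dw) (at p)"
  shows "Dv w = Dw v"
proof -
  have "Dv w \<bullet> b = Dw v \<bullet> b" for b
    by (rule second_derivative_symmetric_real[of S p "\<lambda>x. f x \<bullet> b" "\<lambda>x u. D x u \<bullet> b"])
      (use assms in \<open>auto intro!: has_derivative_inner_left\<close>)
  then have "(Dv w - Dw v) \<bullet> (Dv w - Dw v) = 0" by (simp add: inner_diff_left)
  then show ?thesis by simp
qed

lemma smooth_on_has_derivative: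
  assumes "smooth_on f S" "x \<in> S"
  shows "(f has_derivative frechet_derivative f (at x)) (at x)"
proof -
  have "Ck_on (Suc 0) f S" using assms(1) unfolding smooth_on_def by blast
  then show ?thesis using assms(2) by (simp add: frechet_derivative_works[symmetric])
qed

lemma smooth_on_derivative:
  assumes "smooth_on f S"
  shows "smooth_on (\<lambda>x. frechet_derivative f (at x) v) S"
  unfolding smooth_on_def
proof
  fix k
  have "Ck_on (Suc k) f S" using assms unfolding smooth_on_def by blast
  then show "Ck_on k (\<lambda>x. frechet_derivative f (at x) v) S" by simp
qed

section \<open>The group operations in a chart around the identity\<close>

locale lie_chart = lie_group K T \<A>
  for K :: "('g, 'z) monoid_scheme" (structure) and T :: "'g topology"
    and \<A> :: "('g set \<times> ('g \<Rightarrow> 'e::euclidean_space)) set" +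
  fixes U :: "'g set" and \<phi> :: "'g \<Rightarrow> 'e"
  assumes chart: "(U, \<phi>) \<in> \<A>" and one_in_U: "\<one> \<in> U"
begin

abbreviation \<iota> :: "'e \<Rightarrow> 'g" where "\<iota> \<equiv> inv_into U \<phi>"
abbreviation e :: 'e where "e \<equiv> \<phi> \<one>"
abbreviation V :: "'e set" where "V \<equiv> \<phi> ` U"
abbreviation AdU :: "'g \<Rightarrow> 'e \<Rightarrow> 'e" where "AdU \<equiv> Ad K U \<phi>"

definition mult_chart :: "'e \<times> 'e \<Rightarrow> 'e" where "mult_chart = (\<lambda>(x, y). \<phi> (\<iota> x \<otimes> \<iota> y))"
definition inv_chart :: "'e \<Rightarrow> 'e" where "inv_chart x = \<phi> (inv \<iota> x)"
definition mult_dom :: "('e \<times> 'e) set" where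
  "mult_dom = {(x, y). x \<in> V \<and> y \<in> V \<and> \<iota> x \<otimes> \<iota> y \<in> U}"
definition inv_dom :: "'e set" where "inv_dom = {x \<in> V. inv \<iota> x \<in> U}"

lemma U_carrier: "U \<subseteq> carrier K"
  using chart_dom[OF chart] openin_subset topspace_eq by metis

lemma inj_chart: "inj_on \<phi> U"
  using homeomorphic_imp_injective_map[OF chart_homeo[OF chart]] U_carrier
  by (simp add: topspace_eq Int_absorb1)

lemma iota_chart [simp]: "g \<in> U \<Longrightarrow> \<iota> (\<phi> g) = g"
  by (rule inv_into_f_f[OF inj_chart])

lemma chart_iota [simp]: "x \<in> V \<Longrightarrow> \<phi> (\<iota> x) = x"
  by (rule f_inv_into_f)

lemma iota_mem: assumes "x \<in> V" shows "\<iota> x \<in> U" "\<iota> x \<in> carrier K"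
  using inv_into_into[OF assms] U_carrier by auto

lemma e_mem: "e \<in> V" and iota_e [simp]: "\<iota> e = \<one>"
  using one_in_U by simp_all

text \<open>The continuous inverse supplied by the chart homeomorphism agrees with
  \<open>inv_into U \<phi>\<close> on V.\<close>

lemma iota_continuous: "continuous_map (top_of_set V) T \<iota>"
proof -
  obtain g where g: "homeomorphic_maps (subtopology T U) (top_of_set V) \<phi> g"
    using chart_homeo[OF chart] homeomorphic_map_maps by blast
  then have "continuous_map (top_of_set V) (subtopology T U) g" and gi: "\<forall>x\<in>topspace (subtopology T U). g (\<phi> x) = x"
    unfolding homeomorphic_maps_def by blast+
  then have "continuous_map (top_of_set V) T g" using continuous_map_into_fulltopology by blast
  moreover have "g x = \<iota> x" if "x \<in> V" for x
    using that gi U_carrier by (auto simp: topspace_eq)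
  ultimately show ?thesis by (rule continuous_map_eq) simp
qed

lemma openin_preimage:
  assumes "continuous_map (top_of_set S) T f" "openin T W" "open S"
  shows "open {x \<in> S. f x \<in> W}"
  using openin_continuous_map_preimage[OF assms(1,2)] assms(3) by (simp add: openin_open_eq)

lemma open_V: "open V" using chart_img[OF chart] .
lemma openin_U: "openin T U" using chart_dom[OF chart] .

lemma open_mult_dom: "open mult_dom"
proof -
  have "continuous_map (prod_topology (top_of_set V) (top_of_set V)) T ((\<lambda>(g, h). g \<otimes> h) \<circ> (\<lambda>(x, y). (\<iota> x, \<iota> y)))"
    by (rule continuous_map_compose[OF _ mult_continuous])
      (unfold continuous_map_prod_top, use iota_continuous in blast)
  then have "continuous_map (top_of_set (V \<times> V)) T (\<lambda>z. \<iota> (fst z) \<otimes> \<iota> (snd z))"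
    by (simp add: o_def case_prod_unfold)
  from openin_preimage[OF this openin_U open_Times[OF open_V open_V]] show ?thesis
    by (simp add: mult_dom_def case_prod_unfold conj_assoc mem_Times_iff)
qed

lemma open_inv_dom: "open inv_dom"
  using openin_preimage[OF continuous_map_compose[OF iota_continuous inv_continuous] openin_U open_V]
  by (simp add: inv_dom_def)

lemma e_inv_dom: "e \<in> inv_dom" using e_mem one_in_U by (simp add: inv_dom_def)

section \<open>Derivatives of multiplication and inversion\<close>

lemma smooth_mult: "smooth_on mult_chart mult_dom"
  using mult_smooth[OF chart chart chart] by (simp add: mult_chart_def mult_dom_def)

lemma smooth_inv: "smooth_on inv_chart inv_dom"
  using inv_smooth[OF chart chart] by (simp add: inv_chart_def[abs_def] inv_dom_def)

text \<open>D1 is kept at every base point because Ad is computed away from the identity;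
  \<open>D2 q r\<close> is the second derivative at \<open>(e, e)\<close> in direction q and then
  r.\<close>

definition D1 :: "'e \<times> 'e \<Rightarrow> 'e \<times> 'e \<Rightarrow> 'e" where
  "D1 p q = frechet_derivative mult_chart (at p) q"
definition D2 :: "'e \<times> 'e \<Rightarrow> 'e \<times> 'e \<Rightarrow> 'e" where
  "D2 q = frechet_derivative (\<lambda>p. D1 p q) (at (e, e))"

lemma mult_dom_e: "x \<in> V \<Longrightarrow> (x, e) \<in> mult_dom" "x \<in> V \<Longrightarrow> (e, x) \<in> mult_dom"
  using one_in_U iota_mem by (auto simp: mult_dom_def)

lemma mult_chart_e [simp]: "x \<in> V \<Longrightarrow> mult_chart (x, e) = x" "x \<in> V \<Longrightarrow> mult_chart (e, x) = x"
  using iota_mem by (auto simp: mult_chart_def)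

lemma D1: "p \<in> mult_dom \<Longrightarrow> (mult_chart has_derivative D1 p) (at p)"
  unfolding D1_def by (rule smooth_on_has_derivative[OF smooth_mult])

lemma D2: "((\<lambda>p. D1 p q) has_derivative D2 q) (at (e, e))"
  unfolding D2_def D1_def
  by (rule smooth_on_has_derivative[OF smooth_on_derivative[OF smooth_mult] mult_dom_e(1)[OF e_mem]])

lemma linear_D2: "linear (D2 q)" using has_derivative_linear[OF D2] .

lemma D2_symmetric: "D2 q r = D2 r q"
  by (rule second_derivative_symmetric[OF open_mult_dom mult_dom_e(1)[OF e_mem] D1 D2 D2])

text \<open>Right multiplication by the identity is the identity map near x.\<close>

lemma D1_left: assumes "x \<in> V" shows "D1 (x, e) (u, 0) = u"
proof -
  have "((\<lambda>x. mult_chart (x, e)) has_derivative (\<lambda>u. D1 (x, e) (u, 0))) (at x)"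
    by (rule has_derivative_compose[OF has_derivative_Pair[OF has_derivative_ident has_derivative_const]
          D1[OF mult_dom_e(1)[OF assms]]])
  then have "((\<lambda>x. x) has_derivative (\<lambda>u. D1 (x, e) (u, 0))) (at x)"
    by (rule has_derivative_transform_within_open[OF _ open_V assms]) simp
  from has_derivative_unique[OF this has_derivative_ident] show ?thesis by meson
qed

lemma D1_right: assumes "x \<in> V" shows "D1 (e, x) (0, u) = u"
proof -
  have "((\<lambda>x. mult_chart (e, x)) has_derivative (\<lambda>u. D1 (e, x) (0, u))) (at x)"
    by (rule has_derivative_compose[OF has_derivative_Pair[OF has_derivative_const has_derivative_ident]
          D1[OF mult_dom_e(2)[OF assms]]])
  then have "((\<lambda>x. x) has_derivative (\<lambda>u. D1 (e, x) (0, u))) (at x)"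
    by (rule has_derivative_transform_within_open[OF _ open_V assms]) simp
  from has_derivative_unique[OF this has_derivative_ident] show ?thesis by meson
qed

lemma D1_e: "D1 (e, e) (u, v) = u + v"
proof -
  have "D1 (e, e) ((u, 0) + (0, v)) = D1 (e, e) (u, 0) + D1 (e, e) (0, v)"
    by (rule linear_add[OF has_derivative_linear[OF D1[OF mult_dom_e(1)[OF e_mem]]]])
  then show ?thesis using D1_left[OF e_mem] D1_right[OF e_mem] by simp
qed

text \<open>By \<open>D1_left\<close> the function being differentiated is constant along the first
  factor.\<close>

lemma D2_left: "D2 (u, 0) (v, 0) = 0"
proof -
  have "((\<lambda>x. D1 (x, e) (u, 0)) has_derivative (\<lambda>v. D2 (u, 0) (v, 0))) (at e)"
    by (rule has_derivative_compose[OF has_derivative_Pair[OF has_derivative_ident has_derivative_const] D2])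
  then have "((\<lambda>x. u) has_derivative (\<lambda>v. D2 (u, 0) (v, 0))) (at e)"
    by (rule has_derivative_transform_within_open[OF _ open_V e_mem]) (simp add: D1_left)
  from has_derivative_unique[OF this has_derivative_const] show ?thesis by meson
qed

lemma inv_chart_mem: "x \<in> inv_dom \<Longrightarrow> inv_chart x \<in> V" "x \<in> inv_dom \<Longrightarrow> (x, inv_chart x) \<in> mult_dom"
  using one_in_U iota_mem by (auto simp: inv_dom_def inv_chart_def mult_dom_def)

lemma inv_chart_e [simp]: "inv_chart e = e" by (simp add: inv_chart_def)

text \<open>Differentiating \<open>mult_chart (x, inv_chart x) = e\<close> gives
  \<open>u + ?i u = 0\<close>.\<close>

lemma inv_chart_derivative: "(inv_chart has_derivative uminus) (at e)"
proof -
  let ?i = "frechet_derivative inv_chart (at e)"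
  have i: "(inv_chart has_derivative ?i) (at e)" by (rule smooth_on_has_derivative[OF smooth_inv e_inv_dom])
  then have "((\<lambda>x. (x, inv_chart x)) has_derivative (\<lambda>u. (u, ?i u))) (at e)"
    by (rule has_derivative_Pair[OF has_derivative_ident])
  from has_derivative_compose[OF this, of mult_chart "D1 (e, e)"]
  have "((\<lambda>x. mult_chart (x, inv_chart x)) has_derivative (\<lambda>u. D1 (e, e) (u, ?i u))) (at e)"
    using D1[OF mult_dom_e(1)[OF e_mem]] by simp
  then have "((\<lambda>x. e) has_derivative (\<lambda>u. D1 (e, e) (u, ?i u))) (at e)"
    by (rule has_derivative_transform_within_open[OF _ open_inv_dom e_inv_dom])
      (auto simp: mult_chart_def inv_chart_def inv_dom_def iota_mem)
  from has_derivative_unique[OF this has_derivative_const] have "u + ?i u = 0" for u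
    unfolding D1_e by meson
  then have "?i = uminus" by (auto simp: fun_eq_iff add_eq_0_iff)
  with i show ?thesis by simp
qed

text \<open>A neighbourhood of the identity in which both g and its inverse have coordinates. The
  rules for Ad are proved there, which suffices for derivatives at e.\<close>

definition W :: "'g set" where "W = {g \<in> U. inv g \<in> U}"

lemma W: "openin T W" "\<one> \<in> W" "W \<subseteq> carrier K" "\<And>x. x \<in> inv_dom \<Longrightarrow> \<iota> x \<in> W"
proof -
  have "openin T {g \<in> topspace T. inv g \<in> U}"
    using openin_continuous_map_preimage[OF inv_continuous openin_U] .
  moreover have "W = U \<inter> {g \<in> topspace T. inv g \<in> U}"
    using U_carrier by (auto simp: W_def topspace_eq)
  ultimately show "openin T W" using openin_U by auto
qed (use one_in_U U_carrier iota_mem in \<open>auto simp: W_def inv_dom_def\<close>)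

lemma W_inv_dom: "g \<in> W \<Longrightarrow> \<phi> g \<in> inv_dom"
  by (auto simp: W_def inv_dom_def)

section \<open>Conjugation and the adjoint representation near the identity\<close>

lemma mult_left_continuous: assumes "g \<in> carrier K" "continuous_map X T f" shows "continuous_map X T (\<lambda>x. g \<otimes> f x)"
proof -
  have "continuous_map X (prod_topology T T) (\<lambda>x. (g, f x))"
    using assms by (simp add: continuous_map_pairwise o_def topspace_eq)
  from continuous_map_compose[OF this mult_continuous] show ?thesis by (simp add: o_def)
qed

lemma mult_right_continuous: assumes "g \<in> carrier K" "continuous_map X T f" shows "continuous_map X T (\<lambda>x. f x \<otimes> g)"
proof -
  have "continuous_map X (prod_topology T T) (\<lambda>x. (f x, g))"
    using assms by (simp add: continuous_map_pairwise o_def topspace_eq)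
  from continuous_map_compose[OF this mult_continuous] show ?thesis by (simp add: o_def)
qed

lemma eventually_near_e:
  assumes "continuous_map (top_of_set V) T f" "openin T O'" "f e \<in> O'"
  shows "\<forall>\<^sub>F y in nhds e. y \<in> V \<and> f y \<in> O'"
proof -
  have "\<forall>\<^sub>F y in nhds e. y \<in> {y \<in> V. f y \<in> O'}"
    using openin_preimage[OF assms(1,2) open_V] e_mem assms(3) by (intro eventually_nhds_in_open) auto
  then show ?thesis by simp
qed

lemma conj_continuous:
  assumes "g \<in> carrier K" shows "continuous_map (top_of_set V) T (\<lambda>y. g \<otimes> \<iota> y \<otimes> inv g)"
  using assms by (intro mult_right_continuous mult_left_continuous iota_continuous) auto

definition conj_chart :: "'g \<Rightarrow> 'e \<Rightarrow> 'e" where "conj_chart g y = \<phi> (g \<otimes> \<iota> y \<otimes> inv g)"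

lemma eventually_conj:
  assumes "g \<in> carrier K" "openin T O'" "\<one> \<in> O'"
  shows "\<forall>\<^sub>F y in nhds e. y \<in> V \<and> g \<otimes> \<iota> y \<otimes> inv g \<in> O'"
  using assms by (intro eventually_near_e conj_continuous) auto

lemma conj_chart_e [simp]: "g \<in> carrier K \<Longrightarrow> conj_chart g e = e"
  by (simp add: conj_chart_def)

lemma eventually_nhds_at: "(\<forall>\<^sub>F y in nhds x. P y) \<Longrightarrow> (\<forall>\<^sub>F y in at x. P y)" "(\<forall>\<^sub>F y in nhds x. P y) \<Longrightarrow> P x"
  by (auto simp: eventually_nhds_conv_at)

text \<open>Chain rule: for y close to e the product of g and y is still in U, so conjugation is
  \<open>mult_chart\<close> applied twice.\<close>

lemma conj_chart_derivative_formula: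
  assumes g: "g \<in> W"
  shows "(conj_chart g has_derivative (\<lambda>Y. D1 (\<phi> g, inv_chart (\<phi> g)) (D1 (\<phi> g, e) (0, Y), 0))) (at e)"
proof -
  let ?x = "\<phi> g"
  have gU: "g \<in> U" "inv g \<in> U" "g \<in> carrier K" using g U_carrier by (auto simp: W_def)
  have xV: "?x \<in> V" using gU by blast
  have 1: "((\<lambda>y. mult_chart (?x, y)) has_derivative (\<lambda>Y. D1 (?x, e) (0, Y))) (at e)"
    by (rule has_derivative_compose[OF has_derivative_Pair[OF has_derivative_const has_derivative_ident]
          D1[OF mult_dom_e(1)[OF xV]]])
  have dom: "(mult_chart (?x, e), inv_chart ?x) \<in> mult_dom"
    using inv_chart_mem(2)[OF W_inv_dom[OF g]] xV by simp
  have "((\<lambda>y. mult_chart (mult_chart (?x, y), inv_chart ?x)) has_derivative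
      (\<lambda>Y. D1 (mult_chart (?x, e), inv_chart ?x) (D1 (?x, e) (0, Y), 0))) (at e)"
    by (rule has_derivative_compose[OF has_derivative_Pair[OF 1 has_derivative_const] D1[OF dom]])
  then have 2: "((\<lambda>y. mult_chart (mult_chart (?x, y), inv_chart ?x)) has_derivative
      (\<lambda>Y. D1 (?x, inv_chart ?x) (D1 (?x, e) (0, Y), 0))) (at e)"
    using xV by simp
  have "\<forall>\<^sub>F y in nhds e. y \<in> V \<and> g \<otimes> \<iota> y \<in> U"
    using gU by (intro eventually_near_e mult_left_continuous iota_continuous openin_U) auto
  then have ev: "\<forall>\<^sub>F y in nhds e. mult_chart (mult_chart (?x, y), inv_chart ?x) = conj_chart g y"
    by eventually_elim (use gU in \<open>simp add: mult_chart_def conj_chart_def inv_chart_def\<close>)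
  show ?thesis
    by (rule has_derivative_transform_eventually[OF 2]) (use eventually_nhds_at[OF ev] in auto)
qed

lemma Ad_conj_chart: "AdU g Y = frechet_derivative (conj_chart g) (at e) Y"
  by (simp add: Ad_def conj_chart_def[abs_def])

lemma conj_chart_derivative: "g \<in> W \<Longrightarrow> (conj_chart g has_derivative AdU g) (at e)"
proof -
  assume "g \<in> W"
  from conj_chart_derivative_formula[OF this] have "conj_chart g differentiable at e"
    unfolding differentiable_def by blast
  then have "(conj_chart g has_derivative frechet_derivative (conj_chart g) (at e)) (at e)"
    by (simp add: frechet_derivative_works)
  moreover have "frechet_derivative (conj_chart g) (at e) = AdU g"
    by (rule ext) (rule Ad_conj_chart[symmetric])
  ultimately show ?thesis by simp
qed

lemma linear_Ad: "g \<in> W \<Longrightarrow> linear (AdU g)"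
  using conj_chart_derivative has_derivative_linear by blast

lemma Ad_formula: "g \<in> W \<Longrightarrow> AdU g Y = D1 (\<phi> g, inv_chart (\<phi> g)) (D1 (\<phi> g, e) (0, Y), 0)"
  using has_derivative_unique[OF conj_chart_derivative conj_chart_derivative_formula] by metis

lemma Ad_one: "AdU \<one> Y = Y"
  using Ad_formula[OF W(2)] by (simp add: D1_e)

text \<open>Chain rule for two conjugations, which both fix e. The memberships in W ensure that each
  Ad is a genuine derivative.\<close>

lemma Ad_mult:
  assumes g: "g \<in> W" and h: "h \<in> W" and gh: "g \<otimes> h \<in> W"
  shows "AdU (g \<otimes> h) Y = AdU g (AdU h Y)"
proof -
  have gc: "g \<in> carrier K" and hc: "h \<in> carrier K" using g h W(3) by auto
  have "(conj_chart g has_derivative AdU g) (at (conj_chart h e))"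
    using conj_chart_derivative[OF g] hc by simp
  from has_derivative_compose[OF conj_chart_derivative[OF h] this]
  have 1: "((\<lambda>y. conj_chart g (conj_chart h y)) has_derivative (\<lambda>Y. AdU g (AdU h Y))) (at e)" .
  have ev: "\<forall>\<^sub>F y in nhds e. conj_chart g (conj_chart h y) = conj_chart (g \<otimes> h) y"
    using eventually_conj[OF hc openin_U one_in_U]
  proof eventually_elim
    case (elim y)
    then show ?case using gc hc iota_mem(2)[of y] by (simp add: conj_chart_def inv_mult_group m_assoc)
  qed
  have "(conj_chart (g \<otimes> h) has_derivative (\<lambda>Y. AdU g (AdU h Y))) (at e)"
    by (rule has_derivative_transform_eventually[OF 1]) (use eventually_nhds_at[OF ev] in auto)
  from has_derivative_unique[OF conj_chart_derivative[OF gh] this] show ?thesis by metis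
qed

section \<open>The bracket as the derivative of Ad\<close>

abbreviation br :: "'e \<Rightarrow> 'e \<Rightarrow> 'e" where "br \<equiv> lie_bracket K U \<phi>"

text \<open>The mixed second derivative of the multiplication; the bracket will be its
  antisymmetrisation.\<close>

definition \<beta> :: "'e \<Rightarrow> 'e \<Rightarrow> 'e" where "\<beta> X Y = D2 (0, Y) (X, 0)"

text \<open>In \<open>Ad_formula\<close> the base point and the argument of the outer D1 both vary;
  this expansion separates them for the product rule.\<close>

lemma D1_sum: assumes "p \<in> mult_dom" shows "D1 p (w, 0) = (\<Sum>b\<in>Basis. (w \<bullet> b) *\<^sub>R D1 p (b, 0))"
proof -
  have L: "linear (\<lambda>w. D1 p (w, 0))"
    using linear_compose[OF _ has_derivative_linear[OF D1[OF assms]], of "\<lambda>w. (w, 0)"]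
    by (simp add: o_def linear_iff)
  have "D1 p (\<Sum>b\<in>Basis. (w \<bullet> b) *\<^sub>R b, 0) = (\<Sum>b\<in>Basis. (w \<bullet> b) *\<^sub>R D1 p (b, 0))"
    by (simp only: linear_sum[OF L] linear_scale[OF L])
  then show ?thesis by (simp only: euclidean_representation)
qed

lemma bilinear_beta: "bilinear \<beta>"
  unfolding bilinear_def \<beta>_def
proof (intro conjI allI)
  fix y
  show "linear (\<lambda>x. D2 (0, y) (x, 0))"
    using linear_compose[OF _ linear_D2, of "\<lambda>x. (x, 0)"] by (simp add: o_def linear_iff)
  fix x
  show "linear (\<lambda>y. D2 (0, y) (x, 0))"
    \<comment> \<open>Linearity of D2 is at hand in the second argument; symmetry carries y
      there.\<close>
    unfolding D2_symmetric[of "(0, _)"]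
    using linear_compose[OF _ linear_D2, of "\<lambda>y. (0, y)"] by (simp add: o_def linear_iff)
qed

text \<open>Product rule for \<open>Ad_formula\<close>: the inner factor contributes
  \<open>\<beta> X Y\<close>; the outer one contributes \<open>- \<beta> Y X\<close>, because
  inversion has derivative -1 and \<open>D2_left\<close> removes the other term.\<close>

lemma Ad_has_derivative: "((\<lambda>x. AdU (\<iota> x) Y) has_derivative (\<lambda>X. \<beta> X Y - \<beta> Y X)) (at e)"
proof -
  have w: "((\<lambda>x. D1 (x, e) (0, Y)) has_derivative (\<lambda>X. \<beta> X Y)) (at e)"
    unfolding \<beta>_def
    by (rule has_derivative_compose[OF has_derivative_Pair[OF has_derivative_ident has_derivative_const] D2])
  have "((\<lambda>x. D1 (x, inv_chart x) q) has_derivative (\<lambda>X. D2 q (X, - X))) (at e)" for q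
    by (rule has_derivative_compose[OF has_derivative_Pair[OF has_derivative_ident inv_chart_derivative]])
      (simp add: D2)
  note d = has_derivative_scaleR[OF has_derivative_inner_left[OF w] this]
  let ?F = "\<lambda>x. \<Sum>b\<in>Basis. (D1 (x, e) (0, Y) \<bullet> b) *\<^sub>R D1 (x, inv_chart x) (b, 0)"
  have "(?F has_derivative (\<lambda>X. \<Sum>b\<in>Basis. (D1 (e, e) (0, Y) \<bullet> b) *\<^sub>R D2 (b, 0) (X, - X)
      + (\<beta> X Y \<bullet> b) *\<^sub>R D1 (e, inv_chart e) (b, 0))) (at e)"
    by (rule has_derivative_sum) (rule d)
  moreover have "(\<Sum>b\<in>Basis. (D1 (e, e) (0, Y) \<bullet> b) *\<^sub>R D2 (b, 0) (X, - X)
      + (\<beta> X Y \<bullet> b) *\<^sub>R D1 (e, inv_chart e) (b, 0)) = \<beta> X Y - \<beta> Y X" for X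
  proof -
    have "D2 (b, 0) (X, - X) = - \<beta> b X" for b
    proof -
      have "D2 (b, 0) ((X, 0) - (0, X)) = D2 (b, 0) (X, 0) - D2 (b, 0) (0, X)" by (rule linear_diff[OF linear_D2])
      then show ?thesis by (simp add: D2_left \<beta>_def D2_symmetric[of "(b, 0)"])
    qed
    then have "(\<Sum>b\<in>Basis. (D1 (e, e) (0, Y) \<bullet> b) *\<^sub>R D2 (b, 0) (X, - X)) = - (\<Sum>b\<in>Basis. (Y \<bullet> b) *\<^sub>R \<beta> b X)"
      by (simp add: D1_e sum_negf)
    also have "(\<Sum>b\<in>Basis. (Y \<bullet> b) *\<^sub>R \<beta> b X) = \<beta> (\<Sum>b\<in>Basis. (Y \<bullet> b) *\<^sub>R b) X"
    proof -
      have L: "linear (\<lambda>b. \<beta> b X)" using bilinear_beta unfolding bilinear_def by blast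
      show ?thesis by (simp only: linear_sum[OF L] linear_scale[OF L])
    qed
    finally have "(\<Sum>b\<in>Basis. (D1 (e, e) (0, Y) \<bullet> b) *\<^sub>R D2 (b, 0) (X, - X)) = - \<beta> Y X"
      by (simp only: euclidean_representation)
    moreover have "(\<Sum>b\<in>Basis. (\<beta> X Y \<bullet> b) *\<^sub>R D1 (e, inv_chart e) (b, 0)) = \<beta> X Y"
      by (simp add: D1_e euclidean_representation)
    ultimately show ?thesis by (simp only: sum.distrib) simp
  qed
  ultimately have "(?F has_derivative (\<lambda>X. \<beta> X Y - \<beta> Y X)) (at e)" by simp
  then show ?thesis
  proof (rule has_derivative_transform_within_open[OF _ open_inv_dom e_inv_dom])
    fix x assume x: "x \<in> inv_dom"
    then have xV: "x \<in> V" by (simp add: inv_dom_def)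
    show "?F x = AdU (\<iota> x) Y"
      using Ad_formula[OF W(4)[OF x], of Y] D1_sum[OF inv_chart_mem(2)[OF x], of "D1 (x, e) (0, Y)"] xV by simp
  qed
qed

lemma br_eq: "br X Y = \<beta> X Y - \<beta> Y X"
  using frechet_derivative_at[OF Ad_has_derivative[of Y]] by (metis lie_bracket_def)

lemma Ad_derivative: "((\<lambda>x. AdU (\<iota> x) Y) has_derivative (\<lambda>X. br X Y)) (at e)"
  using Ad_has_derivative by (simp add: br_eq)

lemma bilinear_br: "bilinear br"
  using bilinear_beta unfolding bilinear_def br_eq by (auto intro: linear_compose_sub)

text \<open>Ad of the conjugate of y by g, applied to \<open>AdU g Y\<close>, equals
  \<open>AdU g\<close> applied to Ad of y on Y. Differentiating both in y at e gives the
  claim.\<close>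

lemma Ad_br:
  assumes g: "g \<in> W"
  shows "AdU g (br X Y) = br (AdU g X) (AdU g Y)"
proof -
  have gc: "g \<in> carrier K" using g W(3) by auto
  have "((\<lambda>x. AdU (\<iota> x) (AdU g Y)) has_derivative (\<lambda>X. br X (AdU g Y))) (at (conj_chart g e))"
    using Ad_derivative gc by simp
  from has_derivative_compose[OF conj_chart_derivative[OF g] this]
  have 1: "((\<lambda>y. AdU (\<iota> (conj_chart g y)) (AdU g Y)) has_derivative (\<lambda>X. br (AdU g X) (AdU g Y))) (at e)" .
  have "\<forall>\<^sub>F y in nhds e. y \<in> V \<and> g \<otimes> \<iota> y \<in> W"
    using g gc W by (intro eventually_near_e mult_left_continuous iota_continuous) auto
  moreover have "\<forall>\<^sub>F y in nhds e. y \<in> V \<and> \<iota> y \<in> W"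
    using W(1,2) by (intro eventually_near_e iota_continuous) auto
  moreover note eventually_conj[OF gc W(1,2)]
  \<comment> \<open>The three open conditions keep all factors and products in W, as
    \<open>Ad_mult\<close> requires.\<close>
  ultimately have ev: "\<forall>\<^sub>F y in nhds e. AdU (\<iota> (conj_chart g y)) (AdU g Y) = AdU g (AdU (\<iota> y) Y)"
  proof eventually_elim
    case a: (elim y)
    let ?k = "g \<otimes> \<iota> y \<otimes> inv g"
    have yc: "\<iota> y \<in> carrier K" using a iota_mem by blast
    have kg: "?k \<otimes> g = g \<otimes> \<iota> y" using gc yc by (simp add: m_assoc)
    have "?k \<in> U" using a by (simp add: W_def)
    then have "AdU (\<iota> (conj_chart g y)) (AdU g Y) = AdU ?k (AdU g Y)" by (simp add: conj_chart_def)
    also have "\<dots> = AdU (?k \<otimes> g) Y" using a g kg by (intro Ad_mult[symmetric]) auto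
    also have "\<dots> = AdU g (AdU (\<iota> y) Y)" unfolding kg using a g by (intro Ad_mult) auto
    finally show ?case .
  qed
  have 2: "((\<lambda>y. AdU g (AdU (\<iota> y) Y)) has_derivative (\<lambda>X. br (AdU g X) (AdU g Y))) (at e)"
    by (rule has_derivative_transform_eventually[OF 1]) (use eventually_nhds_at[OF ev] in auto)
  have "bounded_linear (AdU g)" using linear_Ad[OF g] by (simp add: linear_conv_bounded_linear)
  from bounded_linear.has_derivative[OF this Ad_derivative]
  have "((\<lambda>y. AdU g (AdU (\<iota> y) Y)) has_derivative (\<lambda>X. AdU g (br X Y))) (at e)" .
  from has_derivative_unique[OF this 2] show ?thesis by metis
qed

text \<open>Skew symmetry is visible in \<open>br_eq\<close>; the Jacobi identity is the derivative
  of \<open>Ad_br\<close> at e.\<close>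

lemma lie_algebra_br: "lie_algebra br"
proof
  show "bilinear br" by (rule bilinear_br)
  show "br X Y = - br Y X" for X Y by (simp add: br_eq)
  show "br Z (br X Y) = br (br Z X) Y + br X (br Z Y)" for X Y Z
  proof -
    have bb: "bounded_bilinear br" using bilinear_br by (simp add: bilinear_conv_bounded_bilinear)
    have "((\<lambda>x. br (AdU (\<iota> x) X) (AdU (\<iota> x) Y)) has_derivative
        (\<lambda>Z. br (AdU (\<iota> e) X) (br Z Y) + br (br Z X) (AdU (\<iota> e) Y))) (at e)"
      by (rule bounded_bilinear.FDERIV[OF bb Ad_derivative Ad_derivative])
    then have "((\<lambda>x. AdU (\<iota> x) (br X Y)) has_derivative
        (\<lambda>Z. br (AdU (\<iota> e) X) (br Z Y) + br (br Z X) (AdU (\<iota> e) Y))) (at e)"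
      by (rule has_derivative_transform_within_open[OF _ open_inv_dom e_inv_dom]) (simp add: Ad_br W(4))
    from has_derivative_unique[OF this Ad_derivative] show ?thesis
      by (simp add: Ad_one) (metis add.commute)
  qed
qed

lemma Ad_invariant_imp_flow_invariant:
  assumes B: "compact B" "b \<in> B" and inv: "\<And>g. g \<in> carrier K \<Longrightarrow> AdU g ` B = B"
  shows "lin_exp (br Y) t b \<in> B"
proof -
  interpret lie_algebra br by (rule lie_algebra_br)
  have c: "((\<lambda>s. e + s *\<^sub>R Y) has_vector_derivative Y) (at 0)"
    by (auto intro!: derivative_eq_intros simp: has_vector_derivative_def)
  \<comment> \<open>For small s the coordinate line through e in direction Y stays in
    \<open>inv_dom\<close>, so its points give elements of W, where Ad is linear.\<close>
  have "open ((\<lambda>s::real. e + s *\<^sub>R Y) -` inv_dom)"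
    by (intro open_vimage open_inv_dom continuous_intros)
  then obtain \<delta> where \<delta>: "\<delta> > 0" "\<And>s::real. \<bar>s\<bar> < \<delta> \<Longrightarrow> e + s *\<^sub>R Y \<in> inv_dom"
    unfolding open_dist using e_inv_dom by (auto simp: dist_real_def dest!: bspec[of _ _ 0])
  show ?thesis
  proof (rule lin_exp_invariant[OF linear_br B \<delta>(1), where M = "\<lambda>s. AdU (\<iota> (e + s *\<^sub>R Y))"])
    fix s :: real assume "\<bar>s\<bar> < \<delta>"
    then have "\<iota> (e + s *\<^sub>R Y) \<in> W" using \<delta>(2) W(4) by blast
    then show "linear (AdU (\<iota> (e + s *\<^sub>R Y)))" "AdU (\<iota> (e + s *\<^sub>R Y)) ` B \<subseteq> B"
      using linear_Ad inv W(3) by blast+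
  next
    fix v
    show "AdU (\<iota> (e + 0 *\<^sub>R Y)) v = v" by (simp add: Ad_one)
    have "((\<lambda>x. AdU (\<iota> x) v) has_derivative (\<lambda>X. br X v)) (at (e + 0 *\<^sub>R Y))"
      using Ad_derivative by simp
    from has_derivative_compose[OF c[unfolded has_vector_derivative_def] this]
    show "((\<lambda>s. AdU (\<iota> (e + s *\<^sub>R Y)) v) has_vector_derivative br Y v) (at 0)"
      by (simp add: has_vector_derivative_def br_simps)
  qed
qed

end

theorem theorem6p9:
  fixes K :: "('g, 'z) monoid_scheme"
    and T :: "'g topology"
    and \<A> :: "('g set \<times> ('g \<Rightarrow> 'e::euclidean_space)) set"
    and U :: "'g set" and \<phi> :: "'g \<Rightarrow> 'e"
    and br :: "'e \<Rightarrow> 'e \<Rightarrow> 'e"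
    and H B P :: "'e set"
  assumes "lie_group K T \<A>"
    and "compact_space T" and "connected_space T"
    and "(U, \<phi>) \<in> \<A>" and "\<one>\<^bsub>K\<^esub> \<in> U"
    and "br = lie_bracket K U \<phi>"
    and "lie_semisimple br"
    and "cartan_subalgebra br H"
    and "convex_body B" and "0 \<in> B"
    and "\<And>g. g \<in> carrier K \<Longrightarrow> Ad K U \<phi> g ` B = B"
    and "polytope (B \<inter> H)"
    and "P = polar_in br H (B \<inter> H)"
  shows "(\<forall>x. x \<noteq> 0 \<longrightarrow> lie_commuting br (exposed_face br B x)) \<longleftrightarrow>
         (\<forall>p. p extreme_point_of P \<longrightarrow> lie_regular br p)"
proof -
  interpret chart: lie_chart K T \<A> U \<phi>
    using assms(1,4,5) by (simp add: lie_chart_def lie_chart_axioms_def)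
  interpret lie_algebra br unfolding \<open>br = _\<close> by (rule chart.lie_algebra_br)
  \<comment> \<open>Here Ad-invariance of B is replaced by invariance under the flows.\<close>
  interpret invariant_body br B
  proof
    show "lin_exp (br Y) t b \<in> B" if "b \<in> B" for Y t b
      unfolding \<open>br = _\<close>
      using assms(9,11) that by (intro chart.Ad_invariant_imp_flow_invariant) (auto simp: convex_body_def)
  qed (use assms in auto)
  show ?thesis
    using commuting_faces_imp_regular[OF assms(8,12)] regular_imp_commuting_faces[OF assms(8)]
    unfolding \<open>P = _\<close> by blast
qed

end
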